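(* Let $f$ be a $2\pi$-periodic, continuous, complex-valued function which has zeros in $(-\pi,\pi]$. Let also $g$ be a trigonometric polynomial such that $\frac{f}{g}$ has no zeros in $(-\pi,\pi]$. Then, for every $\varepsilon>0$, the interval $[1-\varepsilon,1+\varepsilon]$ is a proper cluster for the singular values of $$\mathcal{P}_n^{-1}\left(\frac fg\right)T_n^{-1}(g)T_n(f),$$ where $\mathcal{P}_n\left(\frac fg\right)$ is either the circulant matrix $\mathcal{C}_n\left(\frac fg\right)$ or the optimal circulant preconditioner $\mathcal{T}_n$ obtained from $T_n\left(\frac fg\right)$.
   Context: For a $2\pi$-periodic function $h$, $T_n(h)$ is the $n\times n$ Toeplitz matrix with $(j,k)$ entry $\frac{1}{2\pi}\int_{-\pi}^{\pi}h(x)\mathrm{e}^{-\mathrm{i}(j-k)x}\,\mathrm{d}x$. $\mathcal{C}_n(h)=\mathcal{F}_n^H\Lambda_n(h)\mathcal{F}_n$ is the circulant matrix with eigenvalues $h\left(\frac{2\pi(k-1)}{n}\right)$, $k=1,\dots,n$, where $\Lambda_n(h)$ is the diagonal matrix of these values (in this order) and $\mathcal{F}_n=\frac{1}{\sqrt n}\left(\omega^{(j-1)(k-1)}\right)_{j,k=1}^n$, $\omega=\mathrm{e}^{2\pi\mathrm{i}/n}$. The optimal (T. Chan) circulant preconditioner of a Toeplitz matrix $T_n=(t_{j-k})$ is the circulant matrix minimizing the Frobenius norm $\Vert C-T_n\Vert_F$ over all $n\times n$ circulant matrices $C$; its entries are $c_k=\frac{(n-k)t_k+k\,t_{k-n}}{n}$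 for $0\le k\le n-1$ and $c_{k}=c_{n+k}$ for $0<-k\le n-1$. A superscript $-1$ denotes the matrix inverse. Proper cluster: a set $\Phi$ is a proper cluster for the singular values of a matrix sequence $\{A_n\}$, $A_n\in\mathbb{C}^{n\times n}$, if for every $\delta>0$ the number of singular values of $A_n$ outside the $\delta$-extension of $\Phi$ (the union of $\Phi$ with all $\delta$-balls centred at its points) is bounded by a constant $c(\delta)$ independent of $n$.
   Formalization: f/g is taken with its limit values at zeros of g and is assumed continuous (the claim fails for jumps, e.g. f=|sin(x-1)|, g=sin(x-1)); the cluster is over those n for which T_n(g) and P_n(f/g) are invertible, and P_n(f/g) is shown to be invertible for all large n. *)

theory Defs
  imports
    "HOL-Analysis.Henstock_Kurzweil_Integration"
    "Jordan_Normal_Form.Spectral_Radius"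
begin

section \<open>Matrix inverse, singular values, proper clusters\<close>

text \<open>\<^const>\<open>mat_inverse\<close> is option-valued; the result is meaningful only
  for invertible arguments, and is used only for these.\<close>

definition inv_mat :: "complex mat \<Rightarrow> complex mat" where
  "inv_mat A = the (mat_inverse A)"

text \<open>Singular values with multiplicity: the square roots of the eigenvalues of \<open>A\<^sup>H A\<close>.
  These eigenvalues are real and nonnegative, so \<^const>\<open>Re\<close> loses nothing.\<close>

definition singular_values :: "complex mat \<Rightarrow> real multiset" where
  "singular_values A = image_mset (\<lambda>z. sqrt (Re z)) (proots (char_poly (mat_adjoint A * A)))"

definition extension :: "real \<Rightarrow> real set \<Rightarrow> real set" where
  "extension \<delta> \<Phi> = \<Phi> \<union> (\<Union>p\<in>\<Phi>. ball p \<delta>)"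

text \<open>The matrix sequences of interest involve inverses and hence need not be defined for every
  index; \<open>N\<close> is the set of indices for which the \<open>n\<close>-th matrix is defined.\<close>

definition proper_cluster :: "nat set \<Rightarrow> real set \<Rightarrow> (nat \<Rightarrow> complex mat) \<Rightarrow> bool" where
  "proper_cluster N \<Phi> A \<longleftrightarrow>
    (\<forall>\<delta>>0. \<exists>c::nat. \<forall>n\<in>N.
       size (filter_mset (\<lambda>s. s \<notin> extension \<delta> \<Phi>) (singular_values (A n))) \<le> c)"

section \<open>Toeplitz and circulant matrices\<close>

text \<open>Matrix indices start at \<open>0\<close>.\<close>

definition fourier_coeff :: "(real \<Rightarrow> complex) \<Rightarrow> int \<Rightarrow> complex" where
  "fourier_coeff h m =
     1 / (2 * of_real pi) * integral {-pi..pi} (\<lambda>x. h x * exp (- \<i> * of_int m * of_real x))"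

definition toeplitz_mat :: "nat \<Rightarrow> (int \<Rightarrow> complex) \<Rightarrow> complex mat" where
  "toeplitz_mat n t = mat n n (\<lambda>(j, k). t (int j - int k))"

definition toeplitz_fun :: "nat \<Rightarrow> (real \<Rightarrow> complex) \<Rightarrow> complex mat" where
  "toeplitz_fun n h = toeplitz_mat n (fourier_coeff h)"

definition fourier_mat :: "nat \<Rightarrow> complex mat" where
  "fourier_mat n =
     mat n n (\<lambda>(j, k). exp (2 * of_real pi * \<i> / of_nat n) ^ (j * k) / of_real (sqrt (real n)))"

definition circulant_fun :: "nat \<Rightarrow> (real \<Rightarrow> complex) \<Rightarrow> complex mat" where
  "circulant_fun n h =
     mat_adjoint (fourier_mat n)
     * mat n n (\<lambda>(j, k). if j = k then h (2 * pi * real k / real n) else 0)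
     * fourier_mat n"

definition circulant_mat :: "nat \<Rightarrow> (nat \<Rightarrow> complex) \<Rightarrow> complex mat" where
  "circulant_mat n c = mat n n (\<lambda>(j, k). c ((n + j - k) mod n))"

definition frobenius_norm :: "complex mat \<Rightarrow> real" where
  "frobenius_norm A = sqrt (\<Sum>j<dim_row A. \<Sum>k<dim_col A. (cmod (A $$ (j, k)))\<^sup>2)"

text \<open>T. Chan's optimal circulant approximation; existence and uniqueness of the minimizer, and
  its entries for Toeplitz \<open>T\<close>, are established below.\<close>

definition optimal_circulant :: "nat \<Rightarrow> complex mat \<Rightarrow> complex mat" where
  "optimal_circulant n T =
     (THE C. C \<in> range (circulant_mat n) \<and>
        (\<forall>D \<in> range (circulant_mat n). frobenius_norm (C - T) \<le> frobenius_norm (D - T)))"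

lemma sum_cmod_diff_mean:
  fixes x :: "nat \<Rightarrow> complex"
  assumes n: "n > 0" and m: "m = (\<Sum>k<n. x k) / of_nat n"
  shows "(\<Sum>k<n. (cmod (c - x k))\<^sup>2) = real n * (cmod (c - m))\<^sup>2 + (\<Sum>k<n. (cmod (m - x k))\<^sup>2)"
proof -
  have nz: "(of_nat n :: complex) \<noteq> 0" using n by simp
  have s: "(\<Sum>k<n. m - x k) = 0"
    using nz by (simp add: m sum_subtractf)
  have e: "(cmod (c - x k))\<^sup>2
      = (cmod (c - m))\<^sup>2 + (cmod (m - x k))\<^sup>2 + 2 * Re ((c - m) * cnj (m - x k))" for k
    unfolding cmod_power2 by (simp add: power2_eq_square algebra_simps)
  have z: "(\<Sum>k<n. Re ((c - m) * cnj (m - x k))) = 0"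
  proof -
    have "(\<Sum>k<n. Re ((c - m) * cnj (m - x k))) = Re ((c - m) * cnj (\<Sum>k<n. m - x k))"
      by (simp only: cnj_sum sum_distrib_left Re_sum)
    then show ?thesis by (simp only: s) simp
  qed
  show ?thesis
    unfolding e sum.distrib sum_distrib_left[symmetric] z by simp
qed

lemma bij_betw_add_mod:
  assumes k: "(k::nat) < n"
  shows "bij_betw (\<lambda>r. (r + k) mod n) {..<n} {..<n}"
proof -
  have inj: "inj_on (\<lambda>r. (r + k) mod n) {..<n}"
  proof (rule inj_onI)
    fix a b assume ab: "a \<in> {..<n}" "b \<in> {..<n}" and eq: "(a + k) mod n = (b + k) mod n"
    have "(c + k) mod n = (if c + k < n then c + k else c + k - n)" if "c < n" for c
      using that k by (simp add: mod_if)
    then show "a = b" using ab eq by (auto split: if_splits)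
  qed
  moreover have "(\<lambda>r. (r + k) mod n) ` {..<n} \<subseteq> {..<n}" using k by auto
  ultimately show ?thesis
    by (simp add: bij_betw_def endo_inj_surj)
qed

lemma circulant_index_shift:
  assumes "r < n" "k < n"
  shows "(n + (r + k) mod n - k) mod n = (r::nat)"
proof (cases "r + k < n")
  case True then show ?thesis using assms by simp
next
  case False
  then have "(r + k) mod n = r + k - n" using assms by (simp add: mod_if)
  then show ?thesis using False assms by simp
qed

lemma frobenius_circulant:
  assumes n: "n > 0" and T: "T \<in> carrier_mat n n"
    and m: "\<And>r. r < n \<Longrightarrow> m r = (\<Sum>k<n. T $$ ((r + k) mod n, k)) / of_nat n"
  shows "(frobenius_norm (circulant_mat n d - T))\<^sup>2
    = real n * (\<Sum>r<n. (cmod (d r - m r))\<^sup>2) + (frobenius_norm (circulant_mat n m - T))\<^sup>2"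
proof -
  have sq: "(frobenius_norm (circulant_mat n d - T))\<^sup>2
      = (\<Sum>r<n. \<Sum>k<n. (cmod (d r - T $$ ((r + k) mod n, k)))\<^sup>2)" for d
  proof -
    have "(frobenius_norm (circulant_mat n d - T))\<^sup>2
        = (\<Sum>j<n. \<Sum>k<n. (cmod (d ((n + j - k) mod n) - T $$ (j, k)))\<^sup>2)"
      using T by (simp add: frobenius_norm_def circulant_mat_def sum_nonneg)
    also have "\<dots> = (\<Sum>k<n. \<Sum>j<n. (cmod (d ((n + j - k) mod n) - T $$ (j, k)))\<^sup>2)"
      by (rule sum.swap)
    also have "\<dots> = (\<Sum>k<n. \<Sum>r<n. (cmod (d r - T $$ ((r + k) mod n, k)))\<^sup>2)"
    proof (rule sum.cong[OF refl])
      fix k assume k: "k \<in> {..<n}"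
      have "(\<Sum>j<n. (cmod (d ((n + j - k) mod n) - T $$ (j, k)))\<^sup>2)
        = (\<Sum>r<n. (cmod (d ((n + (r + k) mod n - k) mod n) - T $$ ((r + k) mod n, k)))\<^sup>2)"
        by (rule sum.reindex_bij_betw[OF bij_betw_add_mod, symmetric]) (use k in simp)
      also have "\<dots> = (\<Sum>r<n. (cmod (d r - T $$ ((r + k) mod n, k)))\<^sup>2)"
        using k by (intro sum.cong) (auto simp: circulant_index_shift)
      finally show "(\<Sum>j<n. (cmod (d ((n + j - k) mod n) - T $$ (j, k)))\<^sup>2)
        = (\<Sum>r<n. (cmod (d r - T $$ ((r + k) mod n, k)))\<^sup>2)" .
    qed
    also have "\<dots> = (\<Sum>r<n. \<Sum>k<n. (cmod (d r - T $$ ((r + k) mod n, k)))\<^sup>2)"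
      by (rule sum.swap)
    finally show ?thesis .
  qed
  have "(\<Sum>r<n. \<Sum>k<n. (cmod (d r - T $$ ((r + k) mod n, k)))\<^sup>2)
      = (\<Sum>r<n. real n * (cmod (d r - m r))\<^sup>2
           + (\<Sum>k<n. (cmod (m r - T $$ ((r + k) mod n, k)))\<^sup>2))"
    using m by (intro sum.cong refl sum_cmod_diff_mean[OF n]) auto
  then show ?thesis
    by (simp add: sq sum.distrib sum_distrib_left)
qed

lemma frobenius_norm_nonneg: "frobenius_norm A \<ge> 0"
  by (simp add: frobenius_norm_def sum_nonneg)

lemma circulant_mat_cong:
  assumes "\<And>r. r < n \<Longrightarrow> c r = d r" "n > 0"
  shows "circulant_mat n c = circulant_mat n d"
  using assms by (auto simp: circulant_mat_def)

lemma optimal_circulant_eq: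
  assumes n: "n > 0" and T: "T \<in> carrier_mat n n"
    and m: "\<And>r. r < n \<Longrightarrow> m r = (\<Sum>k<n. T $$ ((r + k) mod n, k)) / of_nat n"
  shows "optimal_circulant n T = circulant_mat n m"
    and "frobenius_norm (optimal_circulant n T - T) \<le> frobenius_norm (circulant_mat n d - T)"
proof -
  note F = frobenius_circulant[OF n T m]
  have min: "frobenius_norm (circulant_mat n m - T) \<le> frobenius_norm (circulant_mat n d - T)" for d
  proof (rule power2_le_imp_le[OF _ frobenius_norm_nonneg])
    show "(frobenius_norm (circulant_mat n m - T))\<^sup>2 \<le> (frobenius_norm (circulant_mat n d - T))\<^sup>2"
      using F[of d] by (simp add: sum_nonneg)
  qed
  show eq: "optimal_circulant n T = circulant_mat n m"
    unfolding optimal_circulant_def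
  proof (rule the_equality)
    show "circulant_mat n m \<in> range (circulant_mat n) \<and>
      (\<forall>D \<in> range (circulant_mat n).
         frobenius_norm (circulant_mat n m - T) \<le> frobenius_norm (D - T))"
      using min by auto
  next
    fix C assume C: "C \<in> range (circulant_mat n) \<and>
      (\<forall>D \<in> range (circulant_mat n). frobenius_norm (C - T) \<le> frobenius_norm (D - T))"
    then obtain d where d: "C = circulant_mat n d" by auto
    have "frobenius_norm (circulant_mat n d - T) \<le> frobenius_norm (circulant_mat n m - T)"
      using C d by auto
    then have "(frobenius_norm (circulant_mat n d - T))\<^sup>2
        \<le> (frobenius_norm (circulant_mat n m - T))\<^sup>2"
      by (intro power_mono frobenius_norm_nonneg)
    then have "real n * (\<Sum>r<n. (cmod (d r - m r))\<^sup>2) \<le> 0" using F[of d] by simp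
    then have "(\<Sum>r<n. (cmod (d r - m r))\<^sup>2) \<le> 0" using n by (simp add: mult_le_0_iff)
    then have "(\<Sum>r<n. (cmod (d r - m r))\<^sup>2) = 0"
      by (intro antisym sum_nonneg) auto
    then have "d r = m r" if "r < n" for r
      using that by (simp add: sum_nonneg_eq_0_iff)
    then show "C = circulant_mat n m" unfolding d using n by (intro circulant_mat_cong) auto
  qed
  show "frobenius_norm (optimal_circulant n T - T) \<le> frobenius_norm (circulant_mat n d - T)"
    unfolding eq by (rule min)
qed

lemma optimal_circulant_toeplitz:
  assumes n: "n > 0"
  shows "optimal_circulant n (toeplitz_mat n t) = circulant_mat n
    (\<lambda>k. (of_nat (n - k) * t (int k) + of_nat k * t (int k - int n)) / of_nat n)"
proof (rule optimal_circulant_eq(1)[OF n])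
  show "toeplitz_mat n t \<in> carrier_mat n n" by (simp add: toeplitz_mat_def)
next
  fix r assume r: "r < n"
  have "(\<Sum>k<n. toeplitz_mat n t $$ ((r + k) mod n, k))
      = (\<Sum>k<n. if k < n - r then t (int r) else t (int r - int n))"
  proof (rule sum.cong[OF refl])
    fix k assume k: "k \<in> {..<n}"
    show "toeplitz_mat n t $$ ((r + k) mod n, k)
        = (if k < n - r then t (int r) else t (int r - int n))"
    proof (cases "k < n - r")
      case True then show ?thesis using k r by (simp add: toeplitz_mat_def)
    next
      case False
      then have "(r + k) mod n = r + k - n" using k r by (auto simp: mod_if)
      then show ?thesis using False k r by (auto simp: toeplitz_mat_def of_nat_diff)
    qed
  qed
  also have "\<dots> = of_nat (n - r) * t (int r) + of_nat r * t (int r - int n)"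
  proof -
    have "{..<n} \<inter> {k. k < n - r} = {..<n - r}" "{..<n} \<inter> - {k. k < n - r} = {n - r..<n}"
      by auto
    then show ?thesis using r by (simp add: sum.If_cases)
  qed
  finally show "(of_nat (n - r) * t (int r) + of_nat r * t (int r - int n)) / of_nat n
      = (\<Sum>k<n. toeplitz_mat n t $$ ((r + k) mod n, k)) / of_nat n" by simp
qed

section \<open>Trigonometric polynomials and quotients\<close>

definition trig_polynomial :: "(real \<Rightarrow> complex) \<Rightarrow> bool" where
  "trig_polynomial g \<longleftrightarrow>
     (\<exists>(d::nat) (a :: int \<Rightarrow> complex).
        \<forall>x. g x = (\<Sum>k=-int d..int d. a k * exp (\<i> * of_int k * of_real x)))"

text \<open>The function \<open>f / g\<close>, with removable singularities removed: at the zeros of \<open>g\<close> it takes the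
  limit value instead of \<open>f x / 0 = 0\<close>.\<close>

definition ext_quotient :: "(real \<Rightarrow> complex) \<Rightarrow> (real \<Rightarrow> complex) \<Rightarrow> real \<Rightarrow> complex" where
  "ext_quotient f g x = (if g x \<noteq> 0 then f x / g x else Lim (at x) (\<lambda>y. f y / g y))"

end

theory Submission
  imports
    Defs
    "HOL-Analysis.Complex_Transcendental"
    "HOL-Analysis.Weierstrass_Theorems"
begin

text \<open>Write \<open>q\<close> for the quotient \<open>f / g\<close>, a continuous periodic function with \<open>f = g q\<close> and
\<open>|q| \<ge> c > 0\<close>, and \<open>T\<close>, \<open>C\<close> for Toeplitz and circulant matrices. The zeros of \<open>f\<close> are
absorbed by \<open>g\<close>: as \<open>g\<close> is a trigonometric polynomial of some degree \<open>d\<close>, the matrices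
\<open>T(f)\<close> and \<open>T(g) T(q)\<close> differ in at most \<open>2 d\<close> boundary rows (\<open>toeplitz_product_rows\<close>).
Hence \<open>T(g)\<^sup>-\<^sup>1 T(f)\<close> agrees with \<open>T(q)\<close> on a subspace whose codimension does not depend on
\<open>n\<close>, whatever the size of \<open>T(g)\<^sup>-\<^sup>1\<close>, and it remains to compare \<open>T(q)\<close> with the
preconditioner \<open>P\<close>.

For this, \<open>q\<close> is approximated uniformly by a trigonometric polynomial \<open>p\<close>
(\<open>trigonometric_Weierstrass\<close>). The norm of \<open>T(q - p)\<close> is at most the supremum of \<open>|q - p|\<close>
(\<open>toeplitz_norm_bound\<close>), \<open>T(p)\<close> and \<open>C(p)\<close> again differ in boundedly many rows only
(\<open>circulant_toeplitz_rows\<close>), and \<open>C(p) - P\<close> is a circulant with small eigenvalues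
(\<open>preconditioner_is_circulant\<close>). For the optimal preconditioner the last point rests on the
description of its eigenvalues as Rayleigh quotients of the Toeplitz matrix
(\<open>optimal_circulant_eigenvalues\<close>): they are bounded by the supremum of the symbol, and for \<open>p\<close> they converge to
its values, hence those of \<open>q\<close> are eventually close to \<open>p\<close>. Since the eigenvalues of \<open>P\<close> stay away from zero, \<open>P\<close> is invertible for large \<open>n\<close>, and
\<open>P\<^sup>-\<^sup>1 T(g)\<^sup>-\<^sup>1 T(f) x\<close> is within \<open>\<epsilon> \<parallel>x\<parallel>\<close> of \<open>x\<close> for all \<open>x\<close> in a subspace of bounded
codimension. By a dimension count with the eigenvectors of \<open>A\<^sup>H A\<close> this leaves only boundedly
many singular values outside \<open>[1 - \<epsilon>, 1 + \<epsilon>]\<close> (\<open>singular_values_count\<close>).\<close>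

unbundle no vec_syntax
unbundle no inner_syntax

section \<open>Euclidean norm and adjoint matrices\<close>

definition vnorm :: "complex vec \<Rightarrow> real" where
  "vnorm v = L2_set (\<lambda>i. cmod (v $ i)) {0..<dim_vec v}"

lemma vnorm_nonneg [simp]: "vnorm v \<ge> 0"
  by (simp add: vnorm_def)

lemma vnorm_square: "(vnorm v)\<^sup>2 = (\<Sum>i = 0..<dim_vec v. (cmod (v $ i))\<^sup>2)"
  by (simp add: vnorm_def L2_set_def sum_nonneg)

lemma cscalar_prod_self: "v \<bullet>c v = complex_of_real ((vnorm v)\<^sup>2)"
  unfolding vnorm_square scalar_prod_def
  by (simp add: complex_norm_square[unfolded of_real_power, symmetric])

lemma vnorm_zero [simp]: "vnorm (0\<^sub>v n) = 0"
  by (simp add: vnorm_def L2_set_0')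

lemma vnorm_eq_0: "v \<in> carrier_vec n \<Longrightarrow> vnorm v = 0 \<longleftrightarrow> v = 0\<^sub>v n"
  by (auto simp: vnorm_def L2_set_eq_0_iff)

lemma vnorm_pos: "v \<in> carrier_vec n \<Longrightarrow> v \<noteq> 0\<^sub>v n \<Longrightarrow> vnorm v > 0"
  using vnorm_eq_0[of v n] vnorm_nonneg[of v] by linarith

lemma vnorm_smult: "vnorm (c \<cdot>\<^sub>v v) = cmod c * vnorm v"
  by (simp add: vnorm_def norm_mult L2_set_right_distrib cong: L2_set_cong_simp)

lemma vnorm_triangle:
  assumes "u \<in> carrier_vec n" "v \<in> carrier_vec n"
  shows "vnorm (u + v) \<le> vnorm u + vnorm v"
proof -
  have "vnorm (u + v) \<le> L2_set (\<lambda>i. cmod (u $ i) + cmod (v $ i)) {0..<n}"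
    unfolding vnorm_def using assms by (auto intro!: L2_set_mono norm_triangle_ineq)
  also have "\<dots> \<le> vnorm u + vnorm v"
    using L2_set_triangle_ineq assms unfolding vnorm_def by auto
  finally show ?thesis .
qed

lemma vnorm_le_componentwise:
  assumes "u \<in> carrier_vec n" "v \<in> carrier_vec n" "c \<ge> 0"
    and "\<And>i. i < n \<Longrightarrow> cmod (u $ i) \<le> c * cmod (v $ i)"
  shows "vnorm u \<le> c * vnorm v"
proof -
  have "vnorm u \<le> L2_set (\<lambda>i. c * cmod (v $ i)) {0..<n}"
    unfolding vnorm_def using assms by (auto intro!: L2_set_mono)
  also have "\<dots> = c * vnorm v"
    using assms by (simp add: vnorm_def L2_set_right_distrib)
  finally show ?thesis .
qed

lemma mat_adjoint_carrier [simp]: "A \<in> carrier_mat n m \<Longrightarrow> mat_adjoint A \<in> carrier_mat m n"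
  by (auto simp: mat_adjoint_def mat_of_rows_def)

lemma mat_adjoint_dim [simp]:
  "dim_row (mat_adjoint A) = dim_col A" "dim_col (mat_adjoint A) = dim_row A"
  by (auto simp: mat_adjoint_def mat_of_rows_def)

lemma mat_adjoint_index [simp]:
  fixes A :: "complex mat"
  shows "i < dim_col A \<Longrightarrow> j < dim_row A \<Longrightarrow> mat_adjoint A $$ (i, j) = cnj (A $$ (j, i))"
  by (simp add: mat_adjoint_def mat_of_rows_index)

lemma mat_adjoint_adjoint [simp]: "mat_adjoint (mat_adjoint A) = (A :: complex mat)"
  by (rule eq_matI) auto

lemma mat_adjoint_mult:
  fixes A B :: "complex mat"
  assumes "A \<in> carrier_mat n m" "B \<in> carrier_mat m l"
  shows "mat_adjoint (A * B) = mat_adjoint B * mat_adjoint A"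
  using assms by (intro eq_matI) (auto simp: scalar_prod_def intro!: sum.cong)

lemma mat_adjoint_mult_vec:
  fixes A :: "complex mat"
  assumes A: "A \<in> carrier_mat n m" and x: "x \<in> carrier_vec m" and y: "y \<in> carrier_vec n"
  shows "(A *\<^sub>v x) \<bullet>c y = x \<bullet>c (mat_adjoint A *\<^sub>v y)"
proof -
  have "(A *\<^sub>v x) \<bullet>c y = (\<Sum>i = 0..<n. \<Sum>j = 0..<m. A $$ (i, j) * x $ j * cnj (y $ i))"
    using assms by (auto simp: scalar_prod_def sum_distrib_right)
  also have "\<dots> = (\<Sum>j = 0..<m. \<Sum>i = 0..<n. A $$ (i, j) * x $ j * cnj (y $ i))"
    by (rule sum.swap)
  also have "\<dots> = x \<bullet>c (mat_adjoint A *\<^sub>v y)"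
    using assms by (auto simp: scalar_prod_def sum_distrib_left intro!: sum.cong)
  finally show ?thesis .
qed

lemma vnorm_isometry:
  assumes P: "P \<in> carrier_mat n m" and PP: "mat_adjoint P * P = 1\<^sub>m m" and x: "x \<in> carrier_vec m"
  shows "vnorm (P *\<^sub>v x) = vnorm x"
proof -
  have "(P *\<^sub>v x) \<bullet>c (P *\<^sub>v x) = x \<bullet>c (mat_adjoint P *\<^sub>v (P *\<^sub>v x))"
    using P x by (intro mat_adjoint_mult_vec) auto
  also have "mat_adjoint P *\<^sub>v (P *\<^sub>v x) = x"
    using assoc_mult_mat_vec[of "mat_adjoint P" m n P m x] P x PP by auto
  finally have "(vnorm (P *\<^sub>v x))\<^sup>2 = (vnorm x)\<^sup>2"
    unfolding cscalar_prod_self of_real_eq_iff .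
  then show ?thesis by (simp add: power2_eq_iff_nonneg)
qed

section \<open>Diagonalizing Hermitian matrices, counting singular values\<close>

text \<open>Gram--Schmidt yields orthogonal columns only; dividing by their lengths makes the matrix unitary,
so that its inverse is its adjoint and conjugation by it preserves Hermitian matrices.\<close>

lemma unitary_with_first_column:
  assumes v: "v \<in> carrier_vec n" and nz: "v \<noteq> (0\<^sub>v n :: complex vec)"
  obtains W where "W \<in> carrier_mat n n" "mat_adjoint W * W = 1\<^sub>m n"
    "col W 0 = complex_of_real (1 / vnorm v) \<cdot>\<^sub>v v"
proof -
  have n: "n > 0" using v nz by (cases n) auto
  interpret cof_vec_space n "TYPE(complex)" .
  define b where "b = basis_completion v"
  define ws where "ws = gram_schmidt n b"
  define us where "us = map (\<lambda>w. complex_of_real (1 / vnorm w) \<cdot>\<^sub>v w) ws"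
  note B = basis_completion[OF v nz, folded b_def]
  have ws: "set ws \<subseteq> carrier_vec n" "corthogonal ws" "length ws = n"
    using gram_schmidt_result[OF B(2) B(4) B(5) refl, folded ws_def] B(6) by auto
  obtain vs where bv: "b = v # vs" using B(6,7) n by (cases b) auto
  have hd: "hd ws = v" using gram_schmidt_hd[OF v, of vs, folded bv] by (simp add: ws_def)
  have wc: "ws ! i \<in> carrier_vec n" if "i < n" for i using ws that by auto
  have wn: "vnorm (ws ! i) \<noteq> 0" if "i < n" for i
    using corthogonalD[OF ws(2), of i i] that ws(3) by (auto simp: cscalar_prod_self)
  show thesis
  proof
    show W: "mat_of_cols n us \<in> carrier_mat n n"
      by (auto simp: us_def ws(3) mat_of_cols_def)
    have colu: "col (mat_of_cols n us) i = complex_of_real (1 / vnorm (ws ! i)) \<cdot>\<^sub>v (ws ! i)" if "i < n" for i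
      using that ws(3) wc[OF that] by (simp add: us_def)
    show "col (mat_of_cols n us) 0 = complex_of_real (1 / vnorm v) \<cdot>\<^sub>v v"
      using colu[OF n] hd n ws(3) by (metis hd_conv_nth length_greater_0_conv)
    show "mat_adjoint (mat_of_cols n us) * mat_of_cols n us = 1\<^sub>m n"
    proof (rule eq_matI)
      fix i j assume "i < dim_row (1\<^sub>m n :: complex mat)" "j < dim_col (1\<^sub>m n :: complex mat)"
      then have i: "i < n" and j: "j < n" by auto
      let ?U = "mat_of_cols n us"
      have "(mat_adjoint ?U * ?U) $$ (i, j) = col ?U j \<bullet>c col ?U i"
        using i j W
        by (auto simp: scalar_prod_def mult.commute intro!: sum.cong simp del: col_mat_of_cols)
      also have "\<dots> = complex_of_real (1 / vnorm (ws ! j)) * complex_of_real (1 / vnorm (ws ! i))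
          * (ws ! j \<bullet>c ws ! i)"
        using i j wc[OF i] wc[OF j] by (simp add: colu conjugate_smult_vec)
      also have "\<dots> = 1\<^sub>m n $$ (i, j)"
      proof (cases "i = j")
        case True
        then show ?thesis using i wn[OF i] by (simp add: cscalar_prod_self power2_eq_square)
      next
        case False
        then show ?thesis using i j corthogonalD[OF ws(2), of j i] ws(3) by simp
      qed
      finally show "(mat_adjoint ?U * ?U) $$ (i, j) = 1\<^sub>m n $$ (i, j)" .
    qed (use W in auto)
  qed
qed

text \<open>Induction on the size. A unitary matrix whose first column is an eigenvector moves that eigenvalue
to the corner; since the conjugated matrix is still Hermitian, the rest of the first row vanishes
along with the rest of the first column, and the induction hypothesis applies to the complementary
block.\<close>

lemma hermitian_diagonalization:
  assumes "A \<in> carrier_mat n n" "mat_adjoint A = (A :: complex mat)"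
  obtains P D where "P \<in> carrier_mat n n" "mat_adjoint P * P = 1\<^sub>m n" "D \<in> carrier_mat n n"
    "diagonal_mat D" "A = P * D * mat_adjoint P"
proof -
  have "\<exists>P D. P \<in> carrier_mat n n \<and> mat_adjoint P * P = 1\<^sub>m n \<and> D \<in> carrier_mat n n \<and>
    diagonal_mat D \<and> A = P * D * mat_adjoint P"
    using assms
  proof (induction n arbitrary: A)
    case 0
    then show ?case
      by (intro exI[of _ "1\<^sub>m 0"]) (auto simp: diagonal_mat_def intro!: eq_matI)
  next
    case (Suc n A)
    obtain es where es: "char_poly A = (\<Prod>a\<leftarrow>es. [:- a, 1:])" "length es = Suc n"
      using char_poly_factorized[OF Suc.prems(1)] by auto
    then obtain e where e: "poly (char_poly A) e = 0"
      by (cases es) auto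
    then obtain v where v: "eigenvector A v e"
      using eigenvalue_root_char_poly[OF Suc.prems(1)] unfolding eigenvalue_def by auto
    then have vc: "v \<in> carrier_vec (Suc n)" "v \<noteq> 0\<^sub>v (Suc n)" "A *\<^sub>v v = e \<cdot>\<^sub>v v"
      using Suc.prems(1) by (auto simp: eigenvector_def)
    obtain W where W: "W \<in> carrier_mat (Suc n) (Suc n)" "mat_adjoint W * W = 1\<^sub>m (Suc n)"
      "col W 0 = complex_of_real (1 / vnorm v) \<cdot>\<^sub>v v"
      using unitary_with_first_column[OF vc(1,2)] .
    have WW: "W * mat_adjoint W = 1\<^sub>m (Suc n)"
      using mat_mult_left_right_inverse[OF _ W(1) W(2)] W(1) by simp
    define A' where "A' = mat_adjoint W * A * W"
    note Wa = mat_adjoint_carrier[OF W(1)]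
    note A = Suc.prems(1)
    have A'c: "A' \<in> carrier_mat (Suc n) (Suc n)" unfolding A'_def using W A by (intro mult_carrier_mat[of _ _ "Suc n"] mat_adjoint_carrier)
    have A'h: "mat_adjoint A' = A'"
      using W A Wa Suc.prems(2)
      by (simp add: A'_def mat_adjoint_mult[of _ "Suc n" "Suc n" _ "Suc n"]
          assoc_mult_mat[of _ "Suc n" "Suc n" _ "Suc n" _ "Suc n"]
          mult_carrier_mat[of _ "Suc n" "Suc n" _ "Suc n"])
    have AW: "A = W * A' * mat_adjoint W"
    proof -
      have "W * A' * mat_adjoint W = (W * mat_adjoint W) * A * (W * mat_adjoint W)"
        using W A Wa by (simp add: A'_def assoc_mult_mat[of _ "Suc n" "Suc n" _ "Suc n" _ "Suc n"]
          mult_carrier_mat[of _ "Suc n" "Suc n" _ "Suc n"])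
      then show ?thesis using A by (simp add: WW)
    qed
    have col0: "A' $$ (i, 0) = (if i = 0 then e else 0)" if i: "i < Suc n" for i
    proof -
      have cW: "col W 0 \<in> carrier_vec (Suc n)" 
        using W(1) by (metis carrier_matD col_carrier_vec zero_less_Suc)
      have "col A' 0 = mat_adjoint W *\<^sub>v (A *\<^sub>v col W 0)"
        unfolding A'_def
        by (rule trans[OF col_mult2[OF mult_carrier_mat[OF Wa A] W(1)] assoc_mult_mat_vec[OF Wa A cW]]) simp
      also have "A *\<^sub>v col W 0 = e \<cdot>\<^sub>v col W 0"
        using A vc by (simp add: W(3) mult_mat_vec smult_smult_assoc mult.commute)
      also have "mat_adjoint W *\<^sub>v (e \<cdot>\<^sub>v col W 0) = e \<cdot>\<^sub>v col (mat_adjoint W * W) 0"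
        by (simp only: mult_mat_vec[OF Wa cW] col_mult2[OF Wa W(1) zero_less_Suc])
      finally have "col A' 0 $ i = (e \<cdot>\<^sub>v col (1\<^sub>m (Suc n)) 0) $ i" by (simp add: W(2))
      then show ?thesis using i A'c by (auto simp: one_mat_def)
    qed
    have row0: "A' $$ (0, i) = (if i = 0 then e else 0)" if i: "i < Suc n" for i
    proof -
      have "A' $$ (0, i) = cnj (A' $$ (i, 0))"
        using A'c i by (subst A'h[symmetric]) auto
      moreover have "cnj e = e"
        using A'c col0[of 0] mat_adjoint_index[of 0 A' 0] by (simp add: A'h)
      ultimately show ?thesis using col0[OF i] by simp
    qed
    define B where "B = mat n n (\<lambda>(i, j). A' $$ (Suc i, Suc j))"
    have Bc: "B \<in> carrier_mat n n" by (simp add: B_def)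
    have Bh: "mat_adjoint B = B"
    proof (rule eq_matI)
      fix i j assume "i < dim_row B" "j < dim_col B"
      then have ij: "i < n" "j < n" by (auto simp: B_def)
      then have "mat_adjoint B $$ (i, j) = mat_adjoint A' $$ (Suc i, Suc j)"
        using A'c by (simp add: B_def)
      then show "mat_adjoint B $$ (i, j) = B $$ (i, j)" using ij by (simp add: A'h B_def)
    qed (auto simp: B_def)
    obtain P D where P: "P \<in> carrier_mat n n" "mat_adjoint P * P = 1\<^sub>m n" and D: "D \<in> carrier_mat n n"
      "diagonal_mat D" and BP: "B = P * D * mat_adjoint P"
      using Suc.IH[OF Bc Bh] by auto
    let ?E = "mat 1 1 (\<lambda>_. e)"
    define R where "R = four_block_mat (1\<^sub>m 1) (0\<^sub>m 1 n) (0\<^sub>m n 1) P"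
    define K where "K = four_block_mat ?E (0\<^sub>m 1 n) (0\<^sub>m n 1) D"
    have Rc: "R \<in> carrier_mat (Suc n) (Suc n)" and Kc: "K \<in> carrier_mat (Suc n) (Suc n)"
      using P D by (auto simp: R_def K_def)
    have Ra: "mat_adjoint R = four_block_mat (1\<^sub>m 1) (0\<^sub>m 1 n) (0\<^sub>m n 1) (mat_adjoint P)"
      using P by (intro eq_matI) (auto simp: R_def)
    have A'B: "A' = four_block_mat ?E (0\<^sub>m 1 n) (0\<^sub>m n 1) B"
      using A'c Bc by (intro eq_matI) (auto simp: B_def col0 row0)
    have RKR: "R * K * mat_adjoint R = A'"
      unfolding A'B BP Ra unfolding R_def K_def
      using P D mult_carrier_mat[OF mult_carrier_mat[OF P(1) D(1)] mat_adjoint_carrier[OF P(1)]]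
      by (simp add: mult_four_block_mat[of _ 1 1 _ n _ n _ _ 1 _ n] )
    have RR: "mat_adjoint R * R = 1\<^sub>m (Suc n)"
      unfolding Ra unfolding R_def using P
      by (simp add: mult_four_block_mat[of _ 1 1 _ n _ n _ _ 1 _ n] four_block_one_mat[symmetric, of 1 n, simplified])
    show ?case
    proof (intro exI conjI)
      show "W * R \<in> carrier_mat (Suc n) (Suc n)" using W Rc by auto
      have WRa: "mat_adjoint (W * R) = mat_adjoint R * mat_adjoint W"
        using W Rc by (intro mat_adjoint_mult)
      have "mat_adjoint W * (W * R) = R"
        using assoc_mult_mat[OF Wa W(1) Rc] Rc by (simp add: W(2))
      then show "mat_adjoint (W * R) * (W * R) = 1\<^sub>m (Suc n)"
        unfolding WRa
        using assoc_mult_mat[OF mat_adjoint_carrier[OF Rc] Wa mult_carrier_mat[OF W(1) Rc]]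
        by (simp add: RR)
      show "K \<in> carrier_mat (Suc n) (Suc n)" by (rule Kc)
      show "diagonal_mat K"
        using D by (auto simp: K_def diagonal_mat_def)
      have "W * R * K * mat_adjoint (W * R) = W * (R * K * mat_adjoint R) * mat_adjoint W"
        unfolding WRa using W Wa Rc Kc mat_adjoint_carrier[OF Rc]
        by (simp add: assoc_mult_mat[of _ "Suc n" "Suc n" _ "Suc n" _ "Suc n"]
          mult_carrier_mat[of _ "Suc n" "Suc n" _ "Suc n"])
      then show "A = W * R * K * mat_adjoint (W * R)"
        by (simp add: RKR AW[symmetric])
    qed
  qed
  then show thesis using that by blast
qed


text \<open>Padding the functionals with zero rows to a square matrix makes the determinant vanish.\<close>

lemma common_zero_of_functionals:
  assumes vs: "set vs \<subseteq> carrier_vec n" and len: "length vs < n"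
  obtains x :: "complex vec" where "x \<in> carrier_vec n" "x \<noteq> 0\<^sub>v n" "\<And>v. v \<in> set vs \<Longrightarrow> v \<bullet> x = 0"
proof -
  define ws where "ws = vs @ replicate (n - length vs) (0\<^sub>v n)"
  define M where "M = mat_of_rows n ws"
  have lws: "length ws = n" using len by (simp add: ws_def)
  have wsc: "ws ! i \<in> carrier_vec n" if "i < n" for i
    using that vs len by (auto simp: ws_def nth_append dest!: nth_mem)
  have M: "M \<in> carrier_mat n n" by (simp add: M_def mat_of_rows_def lws)
  have "row M (n - 1) = 0\<^sub>v n"
    using len wsc[of "n - 1"]
    by (simp add: M_def lws) (simp add: ws_def nth_append not_less[THEN iffD2])
  then have "M = multrow (n - 1) 0 M"
    using M len by (intro eq_matI) (auto simp: mat_multrow_def vec_eq_iff)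
  then have "det M = 0"
    using det_multrow[of "n - 1" n M 0] M len by simp
  then obtain x where x: "x \<in> carrier_vec n" "x \<noteq> 0\<^sub>v n" "M *\<^sub>v x = 0\<^sub>v n"
    using det_0_iff_vec_prod_zero_field[OF M] by auto
  show thesis
  proof
    fix v assume "v \<in> set vs"
    then obtain i where i: "i < length vs" "v = vs ! i" by (auto simp: in_set_conv_nth)
    then have "(M *\<^sub>v x) $ i = v \<bullet> x"
      using M len wsc[of i] by (simp add: M_def lws) (simp add: ws_def nth_append)
    then show "v \<bullet> x = 0" using x(3) i len by simp
  qed (use x in auto)
qed

lemma size_filter_mset_mset:
  "size (filter_mset Q (mset xs)) = card {i. i < length xs \<and> Q (xs ! i)}"
  by (metis length_filter_conv_card mset_filter size_mset)

text \<open>The link between approximation and clustering: an identity-like behaviour on a subspace of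
codimension \<open>r\<close> leaves at most \<open>2 r\<close> outlying singular values. If more than \<open>r\<close>
singular values exceeded \<open>1 + \<epsilon>\<close>, the span of the corresponding eigenvectors of \<open>A\<^sup>H A\<close>
would meet that subspace in a nonzero vector \<open>x\<close>, and there \<open>\<parallel>A x\<parallel> > (1 + \<epsilon>) \<parallel>x\<parallel>\<close> contradicts
\<open>\<parallel>A x - x\<parallel> \<le> \<epsilon> \<parallel>x\<parallel>\<close>; the singular values below \<open>1 - \<epsilon>\<close> are treated in the same way.\<close>

lemma singular_values_count:
  fixes A :: "complex mat"
  assumes A: "A \<in> carrier_mat n n" and vs: "set vs \<subseteq> carrier_vec n" and \<epsilon>: "\<epsilon> > 0"
    and near: "\<And>x. x \<in> carrier_vec n \<Longrightarrow> (\<forall>v\<in>set vs. v \<bullet> x = 0) \<Longrightarrow> vnorm (A *\<^sub>v x - x) \<le> \<epsilon> * vnorm x"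
  shows "size (filter_mset (\<lambda>s. s \<notin> {1 - \<epsilon>..1 + \<epsilon>}) (singular_values A)) \<le> 2 * length vs"
proof -
  note Aa = mat_adjoint_carrier[OF A]
  have M: "mat_adjoint A * A \<in> carrier_mat n n" using A by auto
  have "mat_adjoint (mat_adjoint A * A) = mat_adjoint A * A"
    using mat_adjoint_mult[OF Aa A] by simp
  from hermitian_diagonalization[OF M this] obtain P D where
    P: "P \<in> carrier_mat n n" "mat_adjoint P * P = 1\<^sub>m n"
    and D: "D \<in> carrier_mat n n" "diagonal_mat D" and MP: "mat_adjoint A * A = P * D * mat_adjoint P" .
  note Pa = mat_adjoint_carrier[OF P(1)]
  have PPa: "P * mat_adjoint P = 1\<^sub>m n"
    using mat_mult_left_right_inverse[OF Pa P(1) P(2)] .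
  define \<mu> where "\<mu> i = Re (D $$ (i, i))" for i
  have AP: "(vnorm (A *\<^sub>v (P *\<^sub>v c)))\<^sup>2 = (\<Sum>i = 0..<n. \<mu> i * (cmod (c $ i))\<^sup>2)"
    if c: "c \<in> carrier_vec n" for c
  proof -
    have Pc: "P *\<^sub>v c \<in> carrier_vec n" using P c by auto
    have "(mat_adjoint A * A) *\<^sub>v (P *\<^sub>v c) = P *\<^sub>v (D *\<^sub>v (mat_adjoint P *\<^sub>v (P *\<^sub>v c)))"
      unfolding MP
      by (simp only: assoc_mult_mat_vec[OF mult_carrier_mat[OF P(1) D(1)] Pa Pc]
          assoc_mult_mat_vec[OF P(1) D(1) mult_mat_vec_carrier[OF Pa Pc]])
    also have "mat_adjoint P *\<^sub>v (P *\<^sub>v c) = c"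
      using assoc_mult_mat_vec[OF Pa P(1) c] P(2) c by simp
    finally have MPc: "(mat_adjoint A * A) *\<^sub>v (P *\<^sub>v c) = P *\<^sub>v (D *\<^sub>v c)" .
    have "complex_of_real ((vnorm (A *\<^sub>v (P *\<^sub>v c)))\<^sup>2) = (P *\<^sub>v c) \<bullet>c (mat_adjoint A *\<^sub>v (A *\<^sub>v (P *\<^sub>v c)))"
      unfolding cscalar_prod_self[symmetric] using A Pc by (intro mat_adjoint_mult_vec) auto
    also have "mat_adjoint A *\<^sub>v (A *\<^sub>v (P *\<^sub>v c)) = P *\<^sub>v (D *\<^sub>v c)"
      using assoc_mult_mat_vec[OF Aa A Pc] MPc by simp
    also have "(P *\<^sub>v c) \<bullet>c (P *\<^sub>v (D *\<^sub>v c)) = c \<bullet>c (mat_adjoint P *\<^sub>v (P *\<^sub>v (D *\<^sub>v c)))"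
      using P c D by (intro mat_adjoint_mult_vec) auto
    also have "mat_adjoint P *\<^sub>v (P *\<^sub>v (D *\<^sub>v c)) = D *\<^sub>v c"
      using assoc_mult_mat_vec[OF Pa P(1), of "D *\<^sub>v c"] P(2) D c by simp
    also have "c \<bullet>c (D *\<^sub>v c) = (\<Sum>i = 0..<n. c $ i * cnj (D $$ (i, i) * c $ i))"
    proof -
      have "(D *\<^sub>v c) $ i = D $$ (i, i) * c $ i" if i: "i < n" for i
      proof -
        have "(D *\<^sub>v c) $ i = (\<Sum>j = 0..<n. D $$ (i, j) * c $ j)"
          using D i c by (simp add: scalar_prod_def)
        also have "\<dots> = (\<Sum>j = 0..<n. if j = i then D $$ (i, i) * c $ i else 0)"
          using D i by (intro sum.cong) (auto simp: diagonal_mat_def)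
        finally show ?thesis using i by simp
      qed
      then show ?thesis using c D by (auto simp: scalar_prod_def intro!: sum.cong)
    qed
    finally have "(vnorm (A *\<^sub>v (P *\<^sub>v c)))\<^sup>2 = Re (\<Sum>i = 0..<n. c $ i * cnj (D $$ (i, i) * c $ i))"
      by (metis Re_complex_of_real)
    also have "\<dots> = (\<Sum>i = 0..<n. \<mu> i * (cmod (c $ i))\<^sup>2)"
      unfolding Re_sum \<mu>_def
      unfolding cmod_power2 by (intro sum.cong refl) (simp add: power2_eq_square algebra_simps)
    finally show ?thesis .
  qed
  have Pn: "vnorm (P *\<^sub>v c) = vnorm c" if "c \<in> carrier_vec n" for c
    using vnorm_isometry[OF P that] .
  have \<mu>0: "\<mu> i \<ge> 0" if i: "i < n" for i
  proof -
    have "(\<Sum>j = 0..<n. \<mu> j * (cmod (unit_vec n i $ j))\<^sup>2) = (\<Sum>j = 0..<n. if j = i then \<mu> i else 0)"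
      using i by (intro sum.cong) auto
    then show ?thesis using AP[of "unit_vec n i"] i zero_le_power2[of "vnorm (A *\<^sub>v (P *\<^sub>v unit_vec n i))"]
      by simp
  qed
  have key: "card S \<le> length vs"
    if S: "S \<subseteq> {..<n}" and ex: "\<And>c. c \<in> carrier_vec n \<Longrightarrow> c \<noteq> 0\<^sub>v n \<Longrightarrow>
      (\<forall>i<n. i \<notin> S \<longrightarrow> c $ i = 0) \<Longrightarrow> (\<forall>v\<in>set vs. v \<bullet> (P *\<^sub>v c) = 0) \<Longrightarrow> False" for S
  proof (rule ccontr)
    assume "\<not> card S \<le> length vs"
    moreover have fin: "finite S" using S finite_subset by auto
    moreover have "card S \<le> n" using card_mono[OF _ S] by simp
    ultimately have lt: "length vs + (n - card S) < n" by linarith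
    obtain js where js: "set js = {..<n} - S" "length js = n - card S"
      using finite_distinct_list[of "{..<n} - S"] distinct_card card_Diff_subset[OF fin S]
      by (metis card_lessThan finite_Diff finite_lessThan)
    \<comment> \<open>The coordinates outside \<open>S\<close> are prescribed to be zero by further functionals, which turns
      the search in the span of the columns with index in \<open>S\<close> into one in the whole space.\<close>
    define us where "us = map (\<lambda>v. transpose_mat P *\<^sub>v v) vs @ map (unit_vec n) js"
    have "set us \<subseteq> carrier_vec n" using vs P by (auto simp: us_def)
    moreover have "length us < n" using lt js by (simp add: us_def)
    ultimately obtain c where c: "c \<in> carrier_vec n" "c \<noteq> 0\<^sub>v n" "\<And>u. u \<in> set us \<Longrightarrow> u \<bullet> c = 0"
      using common_zero_of_functionals by blast
    show False
    proof (rule ex[OF c(1,2)])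
      show "\<forall>i<n. i \<notin> S \<longrightarrow> c $ i = 0"
      proof (intro allI impI)
        fix i assume i: "i < n" "i \<notin> S"
        then have "unit_vec n i \<in> set us" using js by (auto simp: us_def)
        then show "c $ i = 0" using c(3)[of "unit_vec n i"] c(1) i by simp
      qed
      show "\<forall>v\<in>set vs. v \<bullet> (P *\<^sub>v c) = 0"
      proof
        fix v assume v: "v \<in> set vs"
        then have vc: "v \<in> carrier_vec n" using vs by auto
        have "(transpose_mat P *\<^sub>v v) \<bullet> c = v \<bullet> (P *\<^sub>v c)"
          using transpose_vec_mult_scalar[OF P(1) c(1) vc] by simp
        then show "v \<bullet> (P *\<^sub>v c) = 0" using c(3) v by (simp add: us_def)
      qed
    qed
  qed
  have up: "card {i. i < n \<and> sqrt (\<mu> i) > 1 + \<epsilon>} \<le> length vs"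
  proof (rule key)
    fix c assume c: "c \<in> carrier_vec n" "c \<noteq> 0\<^sub>v n"
      and z: "\<forall>i<n. i \<notin> {i. i < n \<and> sqrt (\<mu> i) > 1 + \<epsilon>} \<longrightarrow> c $ i = 0"
      and v: "\<forall>v\<in>set vs. v \<bullet> (P *\<^sub>v c) = 0"
    have Pc: "P *\<^sub>v c \<in> carrier_vec n" using P c by auto
    have "vnorm (A *\<^sub>v (P *\<^sub>v c)) = vnorm ((A *\<^sub>v (P *\<^sub>v c) - P *\<^sub>v c) + P *\<^sub>v c)"
      using A P(1) Pc by (intro arg_cong[of _ _ vnorm] eq_vecI) auto
    also have "\<dots> \<le> \<epsilon> * vnorm c + vnorm c"
      using vnorm_triangle[of "A *\<^sub>v (P *\<^sub>v c) - P *\<^sub>v c" n "P *\<^sub>v c"] near[OF Pc v] A Pc c Pn by fastforce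
    finally have "(vnorm (A *\<^sub>v (P *\<^sub>v c)))\<^sup>2 \<le> ((1 + \<epsilon>) * vnorm c)\<^sup>2"
      by (intro power_mono) (auto simp: algebra_simps)
    then have le: "(\<Sum>i = 0..<n. \<mu> i * (cmod (c $ i))\<^sup>2) \<le> (\<Sum>i = 0..<n. (1 + \<epsilon>)\<^sup>2 * (cmod (c $ i))\<^sup>2)"
      using AP[OF c(1)] vnorm_square[of c] c(1) by (simp add: power_mult_distrib sum_distrib_left)
    obtain i where i: "i < n" "c $ i \<noteq> 0" using c by (metis eq_vecI carrier_vecD index_zero_vec)
    have big: "(1 + \<epsilon>)\<^sup>2 < \<mu> j" if "j < n" "c $ j \<noteq> 0" for j
      using z that \<mu>0[of j] \<epsilon> real_less_rsqrt[of "1+\<epsilon>"] 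
      by (smt (verit) mem_Collect_eq real_sqrt_less_iff real_sqrt_abs abs_of_nonneg)
    have "(\<Sum>i = 0..<n. (1 + \<epsilon>)\<^sup>2 * (cmod (c $ i))\<^sup>2) < (\<Sum>i = 0..<n. \<mu> i * (cmod (c $ i))\<^sup>2)"
    proof (rule sum_strict_mono_ex1)
      show "\<forall>j\<in>{0..<n}. (1 + \<epsilon>)\<^sup>2 * (cmod (c $ j))\<^sup>2 \<le> \<mu> j * (cmod (c $ j))\<^sup>2"
        proof
        fix j assume "j \<in> {0..<n}"
        then show "(1 + \<epsilon>)\<^sup>2 * (cmod (c $ j))\<^sup>2 \<le> \<mu> j * (cmod (c $ j))\<^sup>2" using big[of j] by (cases "c $ j = 0") (auto intro!: mult_right_mono)
      qed
      show "\<exists>j\<in>{0..<n}. (1 + \<epsilon>)\<^sup>2 * (cmod (c $ j))\<^sup>2 < \<mu> j * (cmod (c $ j))\<^sup>2"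
        using big[OF i] i by (intro bexI[of _ i]) auto
    qed auto
    with le show False by linarith
  qed auto
  have down: "card {i. i < n \<and> sqrt (\<mu> i) < 1 - \<epsilon>} \<le> length vs"
  proof (rule key)
    fix c assume c: "c \<in> carrier_vec n" "c \<noteq> 0\<^sub>v n"
      and z: "\<forall>i<n. i \<notin> {i. i < n \<and> sqrt (\<mu> i) < 1 - \<epsilon>} \<longrightarrow> c $ i = 0"
      and v: "\<forall>v\<in>set vs. v \<bullet> (P *\<^sub>v c) = 0"
    have Pc: "P *\<^sub>v c \<in> carrier_vec n" using P c by auto
    have "vnorm c = vnorm (A *\<^sub>v (P *\<^sub>v c) + (-1) \<cdot>\<^sub>v (A *\<^sub>v (P *\<^sub>v c) - P *\<^sub>v c))"
      unfolding Pn[OF c(1), symmetric] 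
      using A P(1) Pc by (intro arg_cong[of _ _ vnorm] eq_vecI) auto
    also have "\<dots> \<le> vnorm (A *\<^sub>v (P *\<^sub>v c)) + vnorm ((-1) \<cdot>\<^sub>v (A *\<^sub>v (P *\<^sub>v c) - P *\<^sub>v c))"
      using A P(1) Pc by (intro vnorm_triangle[of _ n]) auto
    also have "\<dots> \<le> vnorm (A *\<^sub>v (P *\<^sub>v c)) + \<epsilon> * vnorm c"
      using near[OF Pc v] Pn[OF c(1)] by (simp add: vnorm_smult)
    finally have lower: "(1 - \<epsilon>) * vnorm c \<le> vnorm (A *\<^sub>v (P *\<^sub>v c))" by (simp add: algebra_simps)
    obtain i where i: "i < n" "c $ i \<noteq> 0" using c by (metis eq_vecI carrier_vecD index_zero_vec)
    have \<epsilon>1: "1 - \<epsilon> > 0" using z i \<mu>0[of i] by (smt (verit) mem_Collect_eq real_sqrt_ge_zero)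
    then have "((1 - \<epsilon>) * vnorm c)\<^sup>2 \<le> (vnorm (A *\<^sub>v (P *\<^sub>v c)))\<^sup>2"
      using lower by (intro power_mono) auto
    then have le: "(\<Sum>i = 0..<n. (1 - \<epsilon>)\<^sup>2 * (cmod (c $ i))\<^sup>2) \<le> (\<Sum>i = 0..<n. \<mu> i * (cmod (c $ i))\<^sup>2)"
      using AP[OF c(1)] vnorm_square[of c] c(1) by (simp add: power_mult_distrib sum_distrib_left)
    have small: "\<mu> j < (1 - \<epsilon>)\<^sup>2" if "j < n" "c $ j \<noteq> 0" for j
      using z that \<mu>0[of j] \<epsilon>1
      by (smt (verit) mem_Collect_eq real_sqrt_less_iff real_sqrt_abs abs_of_nonneg)
    have "(\<Sum>i = 0..<n. \<mu> i * (cmod (c $ i))\<^sup>2) < (\<Sum>i = 0..<n. (1 - \<epsilon>)\<^sup>2 * (cmod (c $ i))\<^sup>2)"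
    proof (rule sum_strict_mono_ex1)
      show "\<forall>j\<in>{0..<n}. \<mu> j * (cmod (c $ j))\<^sup>2 \<le> (1 - \<epsilon>)\<^sup>2 * (cmod (c $ j))\<^sup>2"
        proof
        fix j assume "j \<in> {0..<n}"
        then show "\<mu> j * (cmod (c $ j))\<^sup>2 \<le> (1 - \<epsilon>)\<^sup>2 * (cmod (c $ j))\<^sup>2" using small[of j] by (cases "c $ j = 0") (auto intro!: mult_right_mono)
      qed
      show "\<exists>j\<in>{0..<n}. \<mu> j * (cmod (c $ j))\<^sup>2 < (1 - \<epsilon>)\<^sup>2 * (cmod (c $ j))\<^sup>2"
        using small[OF i] i by (intro bexI[of _ i]) auto
    qed auto
    with le show False by linarith
  qed auto
  have "similar_mat (mat_adjoint A * A) D"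
    by (rule similar_matI[OF _ PPa P(2) MP]) (use P D Pa M in auto)
  then have "char_poly (mat_adjoint A * A) = char_poly D" by (rule char_poly_similar)
  also have "\<dots> = (\<Prod>a\<leftarrow>diag_mat D. [:- a, 1:])"
    using D by (intro char_poly_upper_triangular) (auto simp: upper_triangular_def diagonal_mat_def)
  finally have cp: "char_poly (mat_adjoint A * A) = (\<Prod>a\<leftarrow>diag_mat D. [:- a, 1:])" .
  have "proots (\<Prod>a\<leftarrow>es. [:- a, 1:]) = mset es" for es :: "complex list"
  proof (induction es)
    case (Cons a es)
    have "(\<Prod>a\<leftarrow>es. [:- a, 1:]) \<noteq> 0" by (auto simp: prod_list_zero_iff)
    then show ?case using Cons by (simp add: proots_mult del: mult_pCons_left)
  qed simp
  then have "singular_values A = image_mset (\<lambda>z. sqrt (Re z)) (mset (diag_mat D))"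
    by (simp only: singular_values_def cp)
  also have "\<dots> = mset (map (\<lambda>i. sqrt (\<mu> i)) [0..<n])"
    using D by (simp add: diag_mat_def \<mu>_def multiset.map_comp o_def)
  finally have "singular_values A = mset (map (\<lambda>i. sqrt (\<mu> i)) [0..<n])" .
  then have "size (filter_mset (\<lambda>s. s \<notin> {1 - \<epsilon>..1 + \<epsilon>}) (singular_values A))
      = card {i. i < n \<and> sqrt (\<mu> i) \<notin> {1 - \<epsilon>..1 + \<epsilon>}}"
    by (simp only: size_filter_mset_mset) (auto intro!: arg_cong[of _ _ card])
  also have "\<dots> \<le> card ({i. i < n \<and> sqrt (\<mu> i) > 1 + \<epsilon>} \<union> {i. i < n \<and> sqrt (\<mu> i) < 1 - \<epsilon>})"
    by (intro card_mono) auto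
  also have "\<dots> \<le> 2 * length vs"
    using card_Un_le[of "{i. i < n \<and> sqrt (\<mu> i) > 1 + \<epsilon>}" "{i. i < n \<and> sqrt (\<mu> i) < 1 - \<epsilon>}"] up down
    by linarith
  finally show ?thesis .
qed

section \<open>Fourier coefficients and Toeplitz matrices\<close>

lemma has_integral_cis:
  "((\<lambda>x. cis (of_int m * x)) has_integral (if m = 0 then 2 * of_real pi else 0)) {-pi..pi}"
proof (cases "m = 0")
  case True
  then show ?thesis using has_integral_const_real[of "1::complex" "-pi" pi] by (simp add: scaleR_conv_of_real)
next
  case False
  let ?F = "\<lambda>x::real. exp (\<i> * of_int m * of_real x) / (\<i> * of_int m)"
  have "((\<lambda>x. exp (\<i> * of_int m * of_real x)) has_integral (?F pi - ?F (-pi))) {-pi..pi}"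
  proof (rule fundamental_theorem_of_calculus)
    fix x :: real
    have "((\<lambda>z. exp (\<i> * of_int m * z) / (\<i> * of_int m)) has_field_derivative
        exp (\<i> * of_int m * of_real x)) (at (of_real x))"
      using False by (auto intro!: derivative_eq_intros)
    then show "(?F has_vector_derivative exp (\<i> * of_int m * of_real x)) (at x within {-pi..pi})"
      by (rule has_vector_derivative_real_field)
  qed simp
  moreover have "exp (\<i> * of_int m * of_real pi) = exp (\<i> * of_int m * of_real (-pi))"
    unfolding exp_eq by (intro exI[of _ m]) simp
  ultimately show ?thesis using False by (simp add: cis_conv_exp mult_ac)
qed

lemma fourier_coeff_cis:
  "fourier_coeff h m = 1 / (2 * of_real pi) * integral {-pi..pi} (\<lambda>x. h x * cis (of_int (- m) * x))"
  by (simp add: fourier_coeff_def cis_conv_exp mult_ac)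

lemma integrable_mult_cis [intro]:
  "continuous_on {-pi..pi} h \<Longrightarrow> (\<lambda>x. h x * cis (of_int m * x)) integrable_on {-pi..pi}"
  by (intro integrable_continuous_real continuous_intros)

text \<open>Multiplication by a trigonometric polynomial is a finite convolution of Fourier coefficients, so
no question of convergence arises when the Toeplitz matrix of a product is compared with the product
of Toeplitz matrices.\<close>

lemma fourier_coeff_trig_mult:
  assumes h: "continuous_on {-pi..pi} h" and K: "finite K"
  shows "fourier_coeff (\<lambda>x. (\<Sum>k\<in>K. a k * cis (of_int k * x)) * h x) m
    = (\<Sum>k\<in>K. a k * fourier_coeff h (m - k))"
proof -
  have "integral {-pi..pi} (\<lambda>x. (\<Sum>k\<in>K. a k * cis (of_int k * x)) * h x * cis (of_int (- m) * x))
      = integral {-pi..pi} (\<lambda>x. \<Sum>k\<in>K. a k * (h x * cis (of_int (- (m - k)) * x)))"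
  proof (rule arg_cong[of _ _ "integral {-pi..pi}"], rule ext)
    fix x
    have "cis (of_int (- (m - k)) * x) = cis (of_int k * x) * cis (of_int (- m) * x)" for k
      by (simp add: cis_mult algebra_simps)
    then show "(\<Sum>k\<in>K. a k * cis (of_int k * x)) * h x * cis (of_int (- m) * x)
      = (\<Sum>k\<in>K. a k * (h x * cis (of_int (- (m - k)) * x)))"
      by (simp only: sum_distrib_right) (simp only: mult_ac)
  qed
  also have "\<dots> = (\<Sum>k\<in>K. integral {-pi..pi} (\<lambda>x. a k * (h x * cis (of_int (- (m - k)) * x))))"
    using K h by (intro integral_sum integrable_on_mult_right integrable_mult_cis)
  also have "\<dots> = (\<Sum>k\<in>K. a k * integral {-pi..pi} (\<lambda>x. h x * cis (of_int (- (m - k)) * x)))"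
    by (simp only: integral_mult_right)
  finally show ?thesis
    unfolding fourier_coeff_cis by (simp add: sum_distrib_left mult_ac)
qed

lemma fourier_coeff_trig:
  assumes "finite K"
  shows "fourier_coeff (\<lambda>x. \<Sum>k\<in>K. a k * cis (of_int k * x)) m = (if m \<in> K then a m else 0)"
proof -
  have one: "fourier_coeff (\<lambda>x. 1) k = (if k = 0 then 1 else 0)" for k
    using integral_unique[OF has_integral_cis[of "-k"]] by (simp add: fourier_coeff_cis)
  have "fourier_coeff (\<lambda>x. \<Sum>k\<in>K. a k * cis (of_int k * x)) m
      = (\<Sum>k\<in>K. a k * fourier_coeff (\<lambda>x. 1) (m - k))"
    using fourier_coeff_trig_mult[of "\<lambda>x. 1" K a m] assms by simp
  also have "\<dots> = (\<Sum>k\<in>K. if k = m then a m else 0)"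
    by (intro sum.cong) (auto simp: one)
  finally show ?thesis using assms by simp
qed

lemma fourier_coeff_diff:
  assumes "continuous_on {-pi..pi} h" "continuous_on {-pi..pi} p"
  shows "fourier_coeff (\<lambda>x. h x - p x) m = fourier_coeff h m - fourier_coeff p m"
  using integral_diff[OF integrable_mult_cis[OF assms(1)] integrable_mult_cis[OF assms(2)], of "-m" "-m"]
  by (simp add: fourier_coeff_cis left_diff_distrib right_diff_distrib diff_divide_distrib)

lemma parseval_trig_sum:
  fixes a :: "nat \<Rightarrow> complex"
  shows "((\<lambda>x. (cmod (\<Sum>k = 0..<n. a k * cis (of_int (int k) * x)))\<^sup>2)
    has_integral (2 * pi * (\<Sum>k = 0..<n. (cmod (a k))\<^sup>2))) {-pi..pi}"
proof -
  let ?X = "\<lambda>x. \<Sum>k = 0..<n. a k * cis (of_int (int k) * x)"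
  have "((\<lambda>x. \<Sum>k = 0..<n. \<Sum>j = 0..<n. a k * cnj (a j) * cis (of_int (int k - int j) * x))
     has_integral (\<Sum>k = 0..<n. \<Sum>j = 0..<n. a k * cnj (a j) * (if int k - int j = 0 then 2 * of_real pi else 0)))
     {-pi..pi}"
    by (intro has_integral_sum has_integral_mult_right has_integral_cis) auto
  also have "(\<lambda>x. \<Sum>k = 0..<n. \<Sum>j = 0..<n. a k * cnj (a j) * cis (of_int (int k - int j) * x))
      = (\<lambda>x. of_real ((cmod (?X x))\<^sup>2))"
  proof
    fix x
    have "complex_of_real ((cmod (?X x))\<^sup>2) = ?X x * cnj (?X x)" by (rule complex_norm_square)
    also have "\<dots> = (\<Sum>k = 0..<n. \<Sum>j = 0..<n. a k * cnj (a j) * cis (of_int (int k - int j) * x))"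
    proof -
      have "cis (of_int (int k - int j) * x) = cis (of_int (int k) * x) * cnj (cis (of_int (int j) * x))" for k j
        by (simp add: cis_cnj cis_mult algebra_simps)
      then show ?thesis
        by (simp only: sum_product cnj_sum complex_cnj_mult) (simp only: mult_ac)
    qed
    finally show "(\<Sum>k = 0..<n. \<Sum>j = 0..<n. a k * cnj (a j) * cis (of_int (int k - int j) * x))
      = of_real ((cmod (?X x))\<^sup>2)" by simp
  qed
  also have "(\<Sum>k = 0..<n. \<Sum>j = 0..<n. a k * cnj (a j) * (if int k - int j = 0 then 2 * of_real pi else 0))
      = (\<Sum>k = 0..<n. \<Sum>j = 0..<n. if j = k then 2 * of_real pi * (a k * cnj (a k)) else 0)"
    by (intro sum.cong) auto
  also have "\<dots> = complex_of_real (2 * pi * (\<Sum>k = 0..<n. (cmod (a k))\<^sup>2))"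
    by (simp add: sum_distrib_left complex_norm_square del: of_real_power)
  finally have "((\<lambda>x. complex_of_real ((cmod (?X x))\<^sup>2))
    has_integral complex_of_real (2 * pi * (\<Sum>k = 0..<n. (cmod (a k))\<^sup>2))) {-pi..pi}" .
  from has_integral_linear[OF this bounded_linear_Re] show ?thesis
    by (simp only: o_def Re_complex_of_real)
qed

text \<open>With \<open>X\<close> and \<open>Y\<close> the trigonometric sums with coefficients \<open>a\<close> and \<open>b\<close>, the form equals
\<open>1 / (2 \<pi>)\<close> times the integral of \<open>h X cnj Y\<close>. The factor \<open>|X Y|\<close> is bounded by
\<open>(|X|\<^sup>2 + |Y|\<^sup>2) / 2\<close>, whose integral is computed by orthogonality; nothing is lost
when \<open>a\<close> and \<open>b\<close> have the same length.\<close>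

lemma toeplitz_form_bound:
  assumes h: "continuous_on {-pi..pi} h" and c: "\<And>x. x \<in> {-pi..pi} \<Longrightarrow> cmod (h x) \<le> c"
  shows "cmod (\<Sum>j = 0..<n. \<Sum>k = 0..<n. fourier_coeff h (int j - int k) * a k * cnj (b j))
    \<le> c / 2 * ((\<Sum>k = 0..<n. (cmod (a k))\<^sup>2) + (\<Sum>j = 0..<n. (cmod (b j))\<^sup>2))"
proof -
  let ?X = "\<lambda>x. \<Sum>k = 0..<n. a k * cis (of_int (int k) * x)"
  let ?Y = "\<lambda>x. \<Sum>k = 0..<n. b k * cis (of_int (int k) * x)"
  have int: "integral {-pi..pi} (\<lambda>x. h x * ?X x * cnj (?Y x))
    = (\<Sum>j = 0..<n. \<Sum>k = 0..<n. a k * cnj (b j) * integral {-pi..pi} (\<lambda>x. h x * cis (of_int (- (int j - int k)) * x)))"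
  proof -
    have "(\<lambda>x. h x * ?X x * cnj (?Y x)) =
      (\<lambda>x. \<Sum>j = 0..<n. \<Sum>k = 0..<n. a k * cnj (b j) * (h x * cis (of_int (- (int j - int k)) * x)))"
    proof
      fix x
      have "cis (of_int (- (int j - int k)) * x) = cis (of_int (int k) * x) * cnj (cis (of_int (int j) * x))" for j k
        by (simp add: cis_cnj cis_mult algebra_simps)
      then show "h x * ?X x * cnj (?Y x) =
        (\<Sum>j = 0..<n. \<Sum>k = 0..<n. a k * cnj (b j) * (h x * cis (of_int (- (int j - int k)) * x)))"
        by (simp only: sum_distrib_left sum_distrib_right cnj_sum complex_cnj_mult) (simp add: mult_ac)
    qed
    then show ?thesis
      by (simp only: integral_sum[OF finite_atLeastLessThan] integrable_sum[OF finite_atLeastLessThan] integral_mult_right integrable_on_mult_right integrable_mult_cis[OF h])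
  qed
  have "cmod (integral {-pi..pi} (\<lambda>x. h x * ?X x * cnj (?Y x)))
      \<le> integral {-pi..pi} (\<lambda>x. c / 2 * ((cmod (?X x))\<^sup>2 + (cmod (?Y x))\<^sup>2))"
  proof (rule integral_norm_bound_integral)
    show "(\<lambda>x. h x * ?X x * cnj (?Y x)) integrable_on {-pi..pi}"
      by (intro integrable_continuous_real continuous_intros h)
    show "(\<lambda>x. c / 2 * ((cmod (?X x))\<^sup>2 + (cmod (?Y x))\<^sup>2)) integrable_on {-pi..pi}"
      by (intro integrable_continuous_real continuous_intros)
    fix x assume x: "x \<in> {-pi..pi}"
    have "cmod (?X x) * cmod (?Y x) \<le> ((cmod (?X x))\<^sup>2 + (cmod (?Y x))\<^sup>2) / 2"
      using sum_squares_bound[of "cmod (?X x)" "cmod (?Y x)"] by simp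
    then show "cmod (h x * ?X x * cnj (?Y x)) \<le> c / 2 * ((cmod (?X x))\<^sup>2 + (cmod (?Y x))\<^sup>2)"
      unfolding norm_mult complex_mod_cnj
      using mult_mono[OF c[OF x], of "cmod (?X x) * cmod (?Y x)" "((cmod (?X x))\<^sup>2 + (cmod (?Y x))\<^sup>2) / 2"]
        order_trans[OF norm_ge_zero c[OF x]]
      by (simp add: mult.assoc)
  qed
  also have "\<dots> = c / 2 * (2 * pi * (\<Sum>k = 0..<n. (cmod (a k))\<^sup>2) + 2 * pi * (\<Sum>j = 0..<n. (cmod (b j))\<^sup>2))"
    by (intro integral_unique has_integral_mult_right has_integral_add parseval_trig_sum)
  also have "\<dots> = 2 * pi * (c / 2 * ((\<Sum>k = 0..<n. (cmod (a k))\<^sup>2) + (\<Sum>j = 0..<n. (cmod (b j))\<^sup>2)))"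
    by (simp add: algebra_simps)
  finally have B: "cmod (integral {-pi..pi} (\<lambda>x. h x * ?X x * cnj (?Y x)))
    \<le> 2 * pi * (c / 2 * ((\<Sum>k = 0..<n. (cmod (a k))\<^sup>2) + (\<Sum>j = 0..<n. (cmod (b j))\<^sup>2)))" .
  have "(\<Sum>j = 0..<n. \<Sum>k = 0..<n. fourier_coeff h (int j - int k) * a k * cnj (b j))
      = 1 / (2 * of_real pi) * integral {-pi..pi} (\<lambda>x. h x * ?X x * cnj (?Y x))"
    unfolding int fourier_coeff_cis by (simp only: sum_distrib_left mult_ac)
  then have "cmod (\<Sum>j = 0..<n. \<Sum>k = 0..<n. fourier_coeff h (int j - int k) * a k * cnj (b j))
      = cmod (integral {-pi..pi} (\<lambda>x. h x * ?X x * cnj (?Y x))) / (2 * pi)"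
    by (simp add: norm_mult norm_divide)
  then show ?thesis using B by (simp add: divide_le_eq mult.commute)
qed

lemma toeplitz_carrier [simp]:
  "toeplitz_mat n t \<in> carrier_mat n n" "toeplitz_fun n h \<in> carrier_mat n n"
  by (auto simp: toeplitz_mat_def toeplitz_fun_def)

lemma toeplitz_dim [simp]: "dim_row (toeplitz_fun n h) = n" "dim_col (toeplitz_fun n h) = n"
  using carrier_matD[OF toeplitz_carrier(2)] by auto

lemma toeplitz_fun_index [simp]:
  "j < n \<Longrightarrow> k < n \<Longrightarrow> toeplitz_fun n h $$ (j, k) = fourier_coeff h (int j - int k)"
  by (auto simp: toeplitz_mat_def toeplitz_fun_def)

lemma toeplitz_norm_bound:
  assumes h: "continuous_on {-pi..pi} h" and c: "\<And>x. x \<in> {-pi..pi} \<Longrightarrow> cmod (h x) \<le> c"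
    and x: "x \<in> carrier_vec n"
  shows "vnorm (toeplitz_fun n h *\<^sub>v x) \<le> c * vnorm x"
proof (cases "vnorm (toeplitz_fun n h *\<^sub>v x) = 0 \<or> vnorm x = 0")
  case True
  have c0: "c \<ge> 0" using order_trans[OF norm_ge_zero c[of 0]] by simp
  show ?thesis
  proof (cases "vnorm x = 0")
    case True
    then have "x = 0\<^sub>v n" using x vnorm_eq_0 by blast
    then have "toeplitz_fun n h *\<^sub>v x = 0\<^sub>v n"
      using carrier_matD[OF toeplitz_carrier(2)[of n h]] by (intro eq_vecI) auto
    then show ?thesis using c0 by simp
  qed (use True c0 in auto)
next
  case False
  define T where "T = toeplitz_fun n h"
  define r where "r = vnorm x"
  define s where "s = vnorm (T *\<^sub>v x)"
  have T: "T \<in> carrier_mat n n" by (simp add: T_def)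
  have pos: "r > 0" "s > 0" using False vnorm_nonneg by (auto simp: r_def s_def T_def less_le)
  \<comment> \<open>The test vector is the image of \<open>x\<close>, rescaled to the length of \<open>x\<close> so that both squared
    norms in the bound coincide.\<close>
  define b where "b j = complex_of_real (r / s) * (T *\<^sub>v x) $ j" for j
  have "(\<Sum>j = 0..<n. \<Sum>k = 0..<n. fourier_coeff h (int j - int k) * x $ k * cnj (b j))
      = (\<Sum>j = 0..<n. (T *\<^sub>v x) $ j * cnj (b j))"
    using x by (simp add: T_def scalar_prod_def sum_distrib_right)
  also have "\<dots> = complex_of_real (r / s) * ((T *\<^sub>v x) \<bullet>c (T *\<^sub>v x))"
  proof -
    have "(\<Sum>j = 0..<n. w $ j * cnj (complex_of_real (r / s) * w $ j)) = complex_of_real (r / s) * (w \<bullet>c w)"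
      if "w \<in> carrier_vec n" for w
      using that by (simp add: scalar_prod_def sum_distrib_left mult_ac)
    from this[of "T *\<^sub>v x"] show ?thesis using T x unfolding b_def by (meson mult_mat_vec_carrier)
  qed
  also have "\<dots> = complex_of_real (r * s)"
    using pos by (simp add: cscalar_prod_self s_def[symmetric] power2_eq_square)
  finally have "r * s = cmod (\<Sum>j = 0..<n. \<Sum>k = 0..<n. fourier_coeff h (int j - int k) * x $ k * cnj (b j))"
    using pos by (simp add: norm_mult)
  also have "\<dots> \<le> c / 2 * ((\<Sum>k = 0..<n. (cmod (x $ k))\<^sup>2) + (\<Sum>j = 0..<n. (cmod (b j))\<^sup>2))"
    by (rule toeplitz_form_bound[OF h c])
  also have "(\<Sum>k = 0..<n. (cmod (x $ k))\<^sup>2) = r\<^sup>2" using x by (simp add: r_def vnorm_square)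
  also have "(\<Sum>j = 0..<n. (cmod (b j))\<^sup>2) = (r / s)\<^sup>2 * s\<^sup>2"
  proof -
    have "(cmod (b j))\<^sup>2 = (r / s)\<^sup>2 * (cmod ((T *\<^sub>v x) $ j))\<^sup>2" for j
      using pos by (simp only: b_def norm_mult power_mult_distrib norm_of_real power2_abs)
    moreover have "s\<^sup>2 = (\<Sum>j = 0..<n. (cmod ((T *\<^sub>v x) $ j))\<^sup>2)"
      using T by (simp only: s_def vnorm_square dim_mult_mat_vec carrier_matD(1))
    ultimately show ?thesis by (simp only: sum_distrib_left)
  qed
  also have "(r / s)\<^sup>2 * s\<^sup>2 = r\<^sup>2" using pos by (simp add: power_divide)
  finally have "r * s \<le> r * (c * r)" by (simp add: power2_eq_square mult_ac)
  then show ?thesis using pos by (simp add: r_def s_def T_def)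
qed

text \<open>In a row at distance at least \<open>d\<close> from both ends, a band of width \<open>d\<close> is not cut off by the
border of the matrix.\<close>

lemma banded_row_sum:
  fixes F :: "int \<Rightarrow> 'a :: comm_monoid_add"
  assumes F: "\<And>m. \<bar>m\<bar> > int d \<Longrightarrow> F m = 0" and j: "d \<le> j" "j + d < n"
  shows "(\<Sum>l = 0..<n. F (int j - int l)) = (\<Sum>m = - int d..int d. F m)"
proof -
  have "(\<Sum>l = 0..<n. F (int j - int l)) = (\<Sum>l\<in>{j - d..j + d}. F (int j - int l))"
    using j by (intro sum.mono_neutral_right) (auto intro!: F)
  also have "\<dots> = (\<Sum>m = - int d..int d. F m)"
    by (rule sum.reindex_bij_witness[of _ "\<lambda>m. nat (int j - m)" "\<lambda>l. int j - int l"]) (use j in auto)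
  finally show ?thesis .
qed

section \<open>Circulant matrices\<close>

lemma sum_cis_roots:
  assumes n: "n > 0"
  shows "(\<Sum>l = 0..<n. cis (2 * pi * real l * of_int m / real n)) = (if int n dvd m then of_nat n else 0)"
proof -
  define z where "z = cis (2 * pi * of_int m / real n)"
  have pw: "cis (2 * pi * real l * of_int m / real n) = z ^ l" for l
    by (simp add: z_def Complex.DeMoivre mult_ac)
  have z1: "z = 1 \<longleftrightarrow> int n dvd m"
  proof
    assume "z = 1"
    then obtain k :: int where "2 * pi * of_int m / real n = of_int (2 * k) * pi"
      unfolding z_def cis_conv_exp exp_eq_1 by auto
    then have "real_of_int m = of_int (k * int n)" using n by (simp add: field_simps)
    then have "m = k * int n" by linarith
    then show "int n dvd m" by simp
  next
    assume "int n dvd m"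
    then obtain k where "m = int n * k" by blast
    then have "2 * pi * of_int m / real n = 2 * pi * real_of_int k" using n by simp
    then have "z = cis (2 * pi * real_of_int k)" by (simp only: z_def)
    also have "\<dots> = 1" by (rule cis_multiple_2pi) simp
    finally show "z = 1" .
  qed
  have "z ^ n = 1" using n by (simp add: z_def Complex.DeMoivre)
  then have "z \<noteq> 1 \<Longrightarrow> (\<Sum>l = 0..<n. z ^ l) = 0"
    using geometric_sum[of z n] by (simp add: lessThan_atLeast0)
  then show ?thesis unfolding pw using z1 by auto
qed

text \<open>The circulant matrix with prescribed eigenvalues, ordered as the columns of the adjoint Fourier
matrix.\<close>

definition circulant_ev :: "nat \<Rightarrow> (nat \<Rightarrow> complex) \<Rightarrow> complex mat" where
  "circulant_ev n ev = mat_adjoint (fourier_mat n) * mat n n (\<lambda>(j, k). if j = k then ev k else 0) * fourier_mat n"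

lemma circulant_fun_ev: "circulant_fun n h = circulant_ev n (\<lambda>k. h (2 * pi * real k / real n))"
  by (simp add: circulant_fun_def circulant_ev_def)

lemma fourier_carrier [simp]: "fourier_mat n \<in> carrier_mat n n"
  by (simp add: fourier_mat_def)

lemma fourier_index:
  "j < n \<Longrightarrow> k < n \<Longrightarrow> fourier_mat n $$ (j, k) = cis (2 * pi * real j * real k / real n) / of_real (sqrt (real n))"
  by (simp add: fourier_mat_def cis_conv_exp exp_of_nat_mult[symmetric] mult_ac)

lemma circulant_ev_carrier [simp]: "circulant_ev n ev \<in> carrier_mat n n"
  by (auto simp: circulant_ev_def intro!: mult_carrier_mat[of _ _ n] mat_adjoint_carrier)

lemma circulant_ev_dim [simp]: "dim_row (circulant_ev n ev) = n" "dim_col (circulant_ev n ev) = n"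
  using carrier_matD[OF circulant_ev_carrier] by auto

lemma circulant_ev_index:
  assumes j: "j < n" and k: "k < n"
  shows "circulant_ev n ev $$ (j, k) = (\<Sum>l = 0..<n. ev l * cis (2 * pi * real l * of_int (int k - int j) / real n)) / of_nat n"
proof -
  let ?L = "mat n n (\<lambda>(j, k). if j = k then ev k else 0)"
  let ?F = "fourier_mat n"
  have F: "dim_row ?F = n" "dim_col ?F = n" using carrier_matD[OF fourier_carrier[of n]] by auto
  have "(mat_adjoint ?F * ?L) $$ (j, l) = cnj (?F $$ (l, j)) * ev l" if l: "l < n" for l
  proof -
    have "(mat_adjoint ?F * ?L) $$ (j, l) = (\<Sum>i = 0..<n. cnj (?F $$ (i, j)) * (if i = l then ev l else 0))"
      using j l F by (simp add: scalar_prod_def)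
    also have "\<dots> = (\<Sum>i = 0..<n. if i = l then cnj (?F $$ (l, j)) * ev l else 0)"
      by (intro sum.cong) auto
    finally show ?thesis using l by simp
  qed
  then have "circulant_ev n ev $$ (j, k) = (\<Sum>l = 0..<n. cnj (?F $$ (l, j)) * ev l * ?F $$ (l, k))"
    using j k F by (simp add: circulant_ev_def scalar_prod_def)
  also have "\<dots> = (\<Sum>l = 0..<n. ev l * cis (2 * pi * real l * of_int (int k - int j) / real n) / of_nat n)"
  proof (intro sum.cong refl)
    fix l assume l: "l \<in> {0..<n}"
    have "cis (2 * pi * real l * of_int (int k - int j) / real n)
        = cnj (cis (2 * pi * real l * real j / real n)) * cis (2 * pi * real l * real k / real n)"
      by (simp add: cis_cnj cis_mult algebra_simps diff_divide_distrib)
    moreover have "complex_of_real (sqrt (real n)) * complex_of_real (sqrt (real n)) = of_nat n"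
      by (simp flip: of_real_mult)
    ultimately show "cnj (?F $$ (l, j)) * ev l * ?F $$ (l, k)
        = ev l * cis (2 * pi * real l * of_int (int k - int j) / real n) / of_nat n"
      using l j k by (simp add: fourier_index mult_ac)
  qed
  finally show ?thesis by (simp add: sum_divide_distrib)
qed

lemma fourier_unitary: "mat_adjoint (fourier_mat n) * fourier_mat n = 1\<^sub>m n"
proof (rule eq_matI)
  let ?F = "fourier_mat n"
  have F: "dim_row ?F = n" "dim_col ?F = n" using carrier_matD[OF fourier_carrier[of n]] by auto
  fix i j assume "i < dim_row (1\<^sub>m n :: complex mat)" "j < dim_col (1\<^sub>m n :: complex mat)"
  then have i: "i < n" and j: "j < n" by auto
  have one: "mat n n (\<lambda>(j, k). if j = k then 1 else 0) = (1\<^sub>m n :: complex mat)"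
    by (intro eq_matI) auto
  have "mat_adjoint ?F * ?F = circulant_ev n (\<lambda>_. 1)"
    using F by (simp add: circulant_ev_def one)
  then have "(mat_adjoint ?F * ?F) $$ (i, j) = (\<Sum>l = 0..<n. cis (2 * pi * real l * of_int (int j - int i) / real n)) / of_nat n"
    using circulant_ev_index[OF i j, of "\<lambda>_. 1"] by simp
  also have "\<dots> = (if int n dvd int j - int i then 1 else 0)"
    using i by (subst sum_cis_roots) auto
  also have "\<dots> = 1\<^sub>m n $$ (i, j)"
    using i j by (auto simp: mod_eq_dvd_iff[symmetric])
  finally show "(mat_adjoint ?F * ?F) $$ (i, j) = 1\<^sub>m n $$ (i, j)" .
qed (use carrier_matD[OF fourier_carrier[of n]] in auto)

text \<open>The vector \<open>y\<close> is the discrete Fourier transform of \<open>x\<close>; it does not depend on the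
eigenvalues.\<close>

lemma vnorm_circulant_ev:
  assumes x: "x \<in> carrier_vec n"
  obtains y where "y \<in> carrier_vec n" "vnorm y = vnorm x"
    "\<And>ev. vnorm (circulant_ev n ev *\<^sub>v x) = vnorm (vec n (\<lambda>i. ev i * y $ i))"
proof
  let ?F = "fourier_mat n"
  note Fa = mat_adjoint_carrier[OF fourier_carrier[of n]]
  show y: "?F *\<^sub>v x \<in> carrier_vec n" using x by (meson fourier_carrier mult_mat_vec_carrier)
  show "vnorm (?F *\<^sub>v x) = vnorm x"
    by (rule vnorm_isometry[OF fourier_carrier fourier_unitary x])
  fix ev :: "nat \<Rightarrow> complex"
  let ?L = "mat n n (\<lambda>(j, k). if j = k then ev k else 0)"
  have L: "?L \<in> carrier_mat n n" by simp
  have "circulant_ev n ev *\<^sub>v x = mat_adjoint ?F *\<^sub>v (?L *\<^sub>v (?F *\<^sub>v x))"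
    unfolding circulant_ev_def
    by (simp only: assoc_mult_mat_vec[OF mult_carrier_mat[OF Fa L] fourier_carrier x]
        assoc_mult_mat_vec[OF Fa L y])
  moreover have "mat_adjoint (mat_adjoint ?F) * mat_adjoint ?F = 1\<^sub>m n"
    using mat_mult_left_right_inverse[OF Fa fourier_carrier fourier_unitary] by simp
  ultimately have "vnorm (circulant_ev n ev *\<^sub>v x) = vnorm (?L *\<^sub>v (?F *\<^sub>v x))"
    using vnorm_isometry[OF Fa, of "?L *\<^sub>v (?F *\<^sub>v x)"] mult_mat_vec_carrier[OF L y] by simp
  also have "?L *\<^sub>v (?F *\<^sub>v x) = vec n (\<lambda>i. ev i * (?F *\<^sub>v x) $ i)"
  proof (rule eq_vecI)
    fix i assume "i < dim_vec (vec n (\<lambda>i. ev i * (?F *\<^sub>v x) $ i))"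
    then have i: "i < n" by simp
    have "(?L *\<^sub>v (?F *\<^sub>v x)) $ i = (\<Sum>j = 0..<n. (if i = j then ev j else 0) * (?F *\<^sub>v x) $ j)"
      using i carrier_vecD[OF y] by (simp add: scalar_prod_def del: index_mult_mat_vec(1)) (simp add: scalar_prod_def)
    also have "\<dots> = (\<Sum>j = 0..<n. if j = i then ev i * (?F *\<^sub>v x) $ i else 0)"
      by (intro sum.cong) auto
    finally show "(?L *\<^sub>v (?F *\<^sub>v x)) $ i = vec n (\<lambda>i. ev i * (?F *\<^sub>v x) $ i) $ i"
      using i by simp
  qed simp
  finally show "vnorm (circulant_ev n ev *\<^sub>v x) = vnorm (vec n (\<lambda>i. ev i * (?F *\<^sub>v x) $ i))" .
qed

lemma circulant_ev_norm_upper: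
  assumes "x \<in> carrier_vec n" "c \<ge> 0" "\<And>i. i < n \<Longrightarrow> cmod (ev i) \<le> c"
  shows "vnorm (circulant_ev n ev *\<^sub>v x) \<le> c * vnorm x"
proof -
  obtain y where y: "y \<in> carrier_vec n" "vnorm y = vnorm x"
    "vnorm (circulant_ev n ev *\<^sub>v x) = vnorm (vec n (\<lambda>i. ev i * y $ i))"
    using vnorm_circulant_ev[OF assms(1)] by metis
  have "vnorm (vec n (\<lambda>i. ev i * y $ i)) \<le> c * vnorm y"
    using assms y by (intro vnorm_le_componentwise) (auto simp: norm_mult intro!: mult_right_mono)
  then show ?thesis using y by simp
qed

lemma circulant_ev_norm_lower:
  assumes "x \<in> carrier_vec n" "c > 0" "\<And>i. i < n \<Longrightarrow> cmod (ev i) \<ge> c"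
  shows "c * vnorm x \<le> vnorm (circulant_ev n ev *\<^sub>v x)"
proof -
  obtain y where y: "y \<in> carrier_vec n" "vnorm y = vnorm x"
    "vnorm (circulant_ev n ev *\<^sub>v x) = vnorm (vec n (\<lambda>i. ev i * y $ i))"
    using vnorm_circulant_ev[OF assms(1)] by metis
  have "vnorm y \<le> (1 / c) * vnorm (vec n (\<lambda>i. ev i * y $ i))"
  proof (intro vnorm_le_componentwise)
    fix i assume "i < n"
    then have "c * cmod (y $ i) \<le> cmod (ev i) * cmod (y $ i)" using assms by (intro mult_right_mono) auto
    then show "cmod (y $ i) \<le> 1 / c * cmod (vec n (\<lambda>i. ev i * y $ i) $ i)"
      using \<open>i < n\<close> assms(2) by (simp add: norm_mult field_simps)
  qed (use assms y in auto)
  then show ?thesis using y assms(2) by (simp add: field_simps)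
qed

lemma circulant_ev_diff: "circulant_ev n ev - circulant_ev n \<mu> = circulant_ev n (\<lambda>i. ev i - \<mu> i)"
  by (intro eq_matI) (auto simp: circulant_ev_index left_diff_distrib sum_subtractf diff_divide_distrib)

text \<open>The eigenvalues of the optimal circulant of \<open>T\<close> are the diagonal entries of \<open>T\<close> in the Fourier
basis, that is, the Rayleigh quotients of \<open>T\<close> at the Fourier vectors. In contrast to the
explicit entries of the circulant, this form shows at once how the eigenvalues are bounded by a
bound of \<open>T\<close>.\<close>

lemma optimal_circulant_eigenvalues:
  assumes n: "n > 0" and T: "T \<in> carrier_mat n n"
  shows "optimal_circulant n T = circulant_ev n (\<lambda>l. (\<Sum>a = 0..<n. \<Sum>b = 0..<n.
    T $$ (a, b) * cis (2 * pi * real l * of_int (int a - int b) / real n)) / of_nat n)"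
    (is "_ = circulant_ev n ?ev")
proof -
  let ?m = "\<lambda>r. (\<Sum>k<n. T $$ ((r + k) mod n, k)) / of_nat n"
  have "circulant_mat n ?m = circulant_ev n ?ev"
  proof (rule eq_matI)
    fix j k assume "j < dim_row (circulant_ev n ?ev)" "k < dim_col (circulant_ev n ?ev)"
    then have j: "j < n" and k: "k < n" by auto
    define r where "r = (n + j - k) mod n"
    have mod: "int n dvd (int a - int b + (int k - int j)) \<longleftrightarrow> a = (r + b) mod n" if "a < n" for a b
    proof -
      have "int ((r + b) mod n) = (int j - int k + int b) mod int n"
      proof -
        have "int ((r + b) mod n) = (int (n + j - k) + int b) mod int n"
          by (simp add: r_def of_nat_mod mod_simps)
        also have "int (n + j - k) + int b = (int j - int k + int b) + int n"
          using k by (simp add: of_nat_diff)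
        finally show ?thesis by simp
      qed
      moreover have "int n dvd (int a - int b + (int k - int j)) \<longleftrightarrow> int a mod int n = (int j - int k + int b) mod int n"
        unfolding mod_eq_dvd_iff by (simp add: algebra_simps)
      moreover have "int a mod int n = int a" using that by simp
      ultimately show ?thesis by (metis of_nat_eq_iff)
    qed
    have "circulant_ev n ?ev $$ (j, k) = (\<Sum>l = 0..<n. \<Sum>a = 0..<n. \<Sum>b = 0..<n.
        T $$ (a, b) * cis (2 * pi * real l * of_int (int a - int b + (int k - int j)) / real n)) / of_nat n / of_nat n"
      unfolding circulant_ev_index[OF j k]
      by (simp add: sum_distrib_right sum_divide_distrib mult.assoc cis_mult add_divide_distrib[symmetric] distrib_left[symmetric])
    also have "(\<Sum>l = 0..<n. \<Sum>a = 0..<n. \<Sum>b = 0..<n.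
        T $$ (a, b) * cis (2 * pi * real l * of_int (int a - int b + (int k - int j)) / real n))
      = (\<Sum>a = 0..<n. \<Sum>b = 0..<n. \<Sum>l = 0..<n.
        T $$ (a, b) * cis (2 * pi * real l * of_int (int a - int b + (int k - int j)) / real n))"
      by (subst sum.swap, subst (2) sum.swap) (rule refl)
    also have "\<dots> = (\<Sum>a = 0..<n. \<Sum>b = 0..<n. if a = (r + b) mod n then of_nat n * T $$ ((r + b) mod n, b) else 0)"
      unfolding sum_distrib_left[symmetric] sum_cis_roots[OF n]
      by (intro sum.cong refl) (auto simp: mod)
    also have "\<dots> = (\<Sum>b = 0..<n. \<Sum>a = 0..<n. if a = (r + b) mod n then of_nat n * T $$ ((r + b) mod n, b) else 0)"
      by (rule sum.swap)
    also have "\<dots> = (\<Sum>b = 0..<n. of_nat n * T $$ ((r + b) mod n, b))"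
      using n by simp
    finally show "circulant_mat n ?m $$ (j, k) = circulant_ev n ?ev $$ (j, k)"
      using j k n by (simp add: circulant_mat_def r_def sum_distrib_left[symmetric] lessThan_atLeast0)
  qed (auto simp: circulant_mat_def)
  then show ?thesis using optimal_circulant_eq(1)[OF n T, of ?m] by simp
qed

section \<open>Trigonometric polynomials\<close>

lemma trig_polynomialE:
  assumes "trig_polynomial g"
  obtains d a where "g = (\<lambda>x. \<Sum>k = -int d..int d. a k * cis (of_int k * x))"
proof -
  obtain d a where "\<And>x. g x = (\<Sum>k = -int d..int d. a k * exp (\<i> * of_int k * of_real x))"
    using assms unfolding trig_polynomial_def by auto
  then have "g = (\<lambda>x. \<Sum>k = -int d..int d. a k * cis (of_int k * x))"
    by (intro ext) (simp add: cis_conv_exp mult.assoc)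
  then show thesis using that by blast
qed

lemma trig_polynomialI:
  "(\<And>x. g x = (\<Sum>k = -int d..int d. a k * cis (of_int k * x))) \<Longrightarrow> trig_polynomial g"
  unfolding trig_polynomial_def
  by (intro exI[of _ d] exI[of _ a]) (simp add: cis_conv_exp mult.assoc)

lemma trig_polynomial_degree_mono:
  assumes g: "g = (\<lambda>x. \<Sum>k = -int d..int d. a k * cis (of_int k * x))" and "d \<le> e"
  shows "g = (\<lambda>x. \<Sum>k = -int e..int e. (if \<bar>k\<bar> \<le> int d then a k else 0) * cis (of_int k * x))"
  unfolding g by (intro ext sum.mono_neutral_cong_left) (use assms in auto)

lemma trig_polynomial_monom: "trig_polynomial (\<lambda>x. c * cis (of_int m * x))"
proof (rule trig_polynomialI)
  fix x
  have "(\<Sum>k = -int (nat \<bar>m\<bar>)..int (nat \<bar>m\<bar>). (if k = m then c else 0) * cis (of_int k * x))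
    = (\<Sum>k = -int (nat \<bar>m\<bar>)..int (nat \<bar>m\<bar>). if k = m then c * cis (of_int m * x) else 0)"
    by (intro sum.cong) auto
  moreover have "- \<bar>m\<bar> \<le> m" "m \<le> \<bar>m\<bar>" by auto
  ultimately show "c * cis (of_int m * x)
    = (\<Sum>k = -int (nat \<bar>m\<bar>)..int (nat \<bar>m\<bar>). (if k = m then c else 0) * cis (of_int k * x))"
    by simp
qed

lemma trig_polynomial_const: "trig_polynomial (\<lambda>x. c)"
  using trig_polynomial_monom[of c 0] by simp

lemma trig_polynomial_add:
  assumes "trig_polynomial g" "trig_polynomial h"
  shows "trig_polynomial (\<lambda>x. g x + h x)"
proof -
  obtain d a where g: "g = (\<lambda>x. \<Sum>k = -int d..int d. a k * cis (of_int k * x))"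
    using assms(1) by (rule trig_polynomialE)
  obtain e b where h: "h = (\<lambda>x. \<Sum>k = -int e..int e. b k * cis (of_int k * x))"
    using assms(2) by (rule trig_polynomialE)
  show ?thesis
    by (subst trig_polynomial_degree_mono[OF g, of "max d e"], simp,
        subst trig_polynomial_degree_mono[OF h, of "max d e"], simp)
      (rule trig_polynomialI, simp only: sum.distrib[symmetric] distrib_right[symmetric])
qed

lemma trig_polynomial_sum:
  "finite K \<Longrightarrow> (\<And>k. k \<in> K \<Longrightarrow> trig_polynomial (g k)) \<Longrightarrow> trig_polynomial (\<lambda>x. \<Sum>k\<in>K. g k x)"
  by (induction K rule: finite_induct) (auto intro!: trig_polynomial_add trig_polynomial_const)

lemma trig_polynomial_mult:
  assumes "trig_polynomial g" "trig_polynomial h"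
  shows "trig_polynomial (\<lambda>x. g x * h x)"
proof -
  obtain d a where g: "g = (\<lambda>x. \<Sum>k = -int d..int d. a k * cis (of_int k * x))"
    using assms(1) by (rule trig_polynomialE)
  obtain e b where h: "h = (\<lambda>x. \<Sum>k = -int e..int e. b k * cis (of_int k * x))"
    using assms(2) by (rule trig_polynomialE)
  have "(\<lambda>x. g x * h x)
    = (\<lambda>x. \<Sum>k = -int d..int d. \<Sum>l = -int e..int e. a k * b l * cis (of_int (k + l) * x))"
  proof
    fix x
    have "cis (of_int (k + l) * x) = cis (of_int k * x) * cis (of_int l * x)" for k l
      by (simp add: cis_mult algebra_simps)
    then show "g x * h x = (\<Sum>k = -int d..int d. \<Sum>l = -int e..int e. a k * b l * cis (of_int (k + l) * x))"
      unfolding g h sum_product by (simp add: mult_ac)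
  qed
  then show ?thesis by (simp only:) (intro trig_polynomial_sum trig_polynomial_monom finite_atLeastAtMost_int)
qed

lemma trig_polynomial_continuous: "trig_polynomial g \<Longrightarrow> continuous_on S g"
  by (elim trig_polynomialE) (auto intro!: continuous_intros)

lemma trig_polynomial_periodic:
  assumes "trig_polynomial g"
  shows "g (x + 2 * pi) = g x"
proof -
  obtain d a where g: "g = (\<lambda>x. \<Sum>k = -int d..int d. a k * cis (of_int k * x))"
    using assms by (rule trig_polynomialE)
  have "cis (of_int k * (x + 2 * pi)) = cis (of_int k * x)" for k
    using cis_multiple_2pi[of "of_int k"] by (simp add: distrib_left mult_ac flip: cis_mult)
  then show ?thesis by (simp add: g)
qed

text \<open>Restricted to the unit circle, a polynomial in the real and imaginary parts is a polynomial in
\<open>cos x\<close> and \<open>sin x\<close>.\<close>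

lemma trig_polynomial_of_circle:
  assumes "real_polynomial_function r"
  shows "trig_polynomial (\<lambda>x. complex_of_real (r (cis x)))"
  using assms
proof (induction rule: real_polynomial_function.induct)
  case (linear r)
  interpret bounded_linear r by fact
  have cs: "trig_polynomial (\<lambda>x. complex_of_real (cos x))" "trig_polynomial (\<lambda>x. complex_of_real (sin x))"
  proof -
    have "complex_of_real (cos x) = (1/2) * cis (of_int 1 * x) + (1/2) * cis (of_int (-1) * x)"
      "complex_of_real (sin x) = (-\<i>/2) * cis (of_int 1 * x) + (\<i>/2) * cis (of_int (-1) * x)" for x
      by (simp_all add: complex_eq_iff)
    then show "trig_polynomial (\<lambda>x. complex_of_real (cos x))" "trig_polynomial (\<lambda>x. complex_of_real (sin x))"
      by (simp_all only: trig_polynomial_add trig_polynomial_monom)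
  qed
  have "r (cis x) = cos x * r 1 + sin x * r \<i>" for x
  proof -
    have "cis x = cos x *\<^sub>R 1 + sin x *\<^sub>R \<i>" by (simp add: complex_eq_iff)
    then show ?thesis by (simp add: add scaleR)
  qed
  then show ?case
    by (simp only: of_real_add of_real_mult)
      (intro trig_polynomial_add trig_polynomial_mult trig_polynomial_const cs)
next
  case (const c)
  then show ?case by (intro trig_polynomial_const)
next
  case (add f g)
  then show ?case by (simp add: trig_polynomial_add)
next
  case (mult f g)
  then show ?case by (simp add: trig_polynomial_mult)
qed

lemma periodic_cis_cong:
  fixes q :: "real \<Rightarrow> 'a"
  assumes per: "\<And>x. q (x + 2 * pi) = q x" and eq: "cis x = cis y"
  shows "q x = q y"
proof -
  have n: "q (x + 2 * pi * real n) = q x" for x n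
  proof (induction n)
    case (Suc n)
    then show ?case using per[of "x + 2 * pi * real n"] by (simp add: algebra_simps)
  qed simp
  have "exp (\<i> * of_real x) = exp (\<i> * of_real y)" using eq by (simp add: cis_conv_exp)
  then obtain k :: int where "\<i> * of_real x = \<i> * of_real y + (of_int (2 * k) * pi) * \<i>"
    unfolding exp_eq by auto
  then have "\<i> * of_real x = \<i> * of_real (y + 2 * pi * of_int k)" by (simp add: algebra_simps)
  then have x: "x = y + 2 * pi * of_int k" unfolding mult_cancel_left of_real_eq_iff by simp
  show ?thesis
  proof (cases "k \<ge> 0")
    case True
    then show ?thesis using n[of y "nat k"] x by simp
  next
    case False
    then have "y = x + 2 * pi * real (nat (- k))" using x by simp
    then show ?thesis using n[of x "nat (- k)"] by metis
  qed
qed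

text \<open>A \<open>2 \<pi>\<close>-periodic function is determined by its values on the range of \<open>Arg\<close>, the half-open
interval from \<open>- \<pi>\<close> to \<open>\<pi>\<close>.\<close>

lemma periodic_Arg:
  assumes "\<And>x. q (x + 2 * pi) = q x"
  shows "q (Arg (cis x)) = q x"
  by (rule periodic_cis_cong[of q, OF assms]) (simp add: cis_Arg sgn_eq)

text \<open>The Stone--Weierstrass theorem is applied to the function \<open>Q\<close> that \<open>q\<close> induces on the unit
circle; on the interval itself it would not apply, as trigonometric polynomials do not separate the
end points.\<close>

lemma trigonometric_Weierstrass:
  fixes q :: "real \<Rightarrow> complex"
  assumes cont: "continuous_on UNIV q" and per: "\<And>x. q (x + 2 * pi) = q x" and e: "e > 0"
  obtains p where "trig_polynomial p" "\<And>x. cmod (q x - p x) < e"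
proof -
  define Q where "Q z = q (Arg z)" for z
  have Qcis: "Q (cis x) = q x" for x using periodic_Arg[of q, OF per] by (simp add: Q_def)
  have "continuous_on (sphere 0 1) Q"
    unfolding continuous_on_eq_continuous_within
  proof
    fix z0 :: complex assume z0: "z0 \<in> sphere 0 1"
    \<comment> \<open>\<open>Arg\<close> jumps on the negative real axis, so near \<open>z0\<close> the angle is measured from \<open>x0\<close>;
      by periodicity this does not change \<open>Q\<close>.\<close>
    define x0 where "x0 = Arg z0"
    have "z0 \<noteq> 0" using z0 by auto
    then have z0': "z0 \<noteq> 0" "z0 = cis x0" using z0 by (auto simp: x0_def cis_Arg sgn_eq)
    have 1: "isCont (\<lambda>z. z / z0) z0" using z0' by (intro continuous_intros) auto
    have 2: "isCont (\<lambda>z. Arg (z / z0)) z0"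
      using isCont_o2[OF 1 continuous_at_Arg] z0' by simp
    have "isCont q y" for y using cont by (simp add: continuous_on_eq_continuous_at)
    then have 3: "isCont (\<lambda>z. q (x0 + Arg (z / z0))) z0"
      using isCont_o2[of z0 "\<lambda>z. x0 + Arg (z / z0)" q] 2 by (simp add: continuous_add)
    have eq: "q (x0 + Arg (z / z0)) = Q z" if z: "z \<in> sphere 0 1" for z
    proof -
      have "z / z0 \<noteq> 0" "cmod (z / z0) = 1" using z z0 z0' by (auto simp: norm_divide)
      then have "cis (x0 + Arg (z / z0)) = z"
        using z0' by (simp add: cis_mult[symmetric] cis_Arg sgn_eq)
      then show ?thesis using Qcis by metis
    qed
    show "continuous (at z0 within sphere 0 1) Q"
    proof (rule continuous_transform_within)
      show "continuous (at z0 within sphere 0 1) (\<lambda>z. q (x0 + Arg (z / z0)))"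
        by (rule continuous_at_imp_continuous_at_within[OF 3])
      show "(0::real) < 1" by simp
    qed (use z0 eq in auto)
  qed
  then obtain G where G: "polynomial_function G" "\<And>z. z \<in> sphere 0 1 \<Longrightarrow> cmod (Q z - G z) < e"
    using Stone_Weierstrass_polynomial_function[OF compact_sphere, of 0 1 Q e] e by auto
  have "trig_polynomial (\<lambda>x. complex_of_real (Re (G (cis x))))" "trig_polynomial (\<lambda>x. complex_of_real (Im (G (cis x))))"
    using G(1) trig_polynomial_of_circle[of "Re \<circ> G"] trig_polynomial_of_circle[of "Im \<circ> G"]
      bounded_linear_Re bounded_linear_Im by (auto simp: polynomial_function_def)
  then have "trig_polynomial (\<lambda>x. complex_of_real (Re (G (cis x))) + \<i> * complex_of_real (Im (G (cis x))))"
    by (intro trig_polynomial_add trig_polynomial_mult trig_polynomial_const)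
  then have "trig_polynomial (\<lambda>x. G (cis x))" by (simp flip: complex_eq)
  moreover have "cmod (q x - G (cis x)) < e" for x
    using G(2)[of "cis x"] by (simp add: Qcis)
  ultimately show thesis using that by blast
qed

section \<open>Toeplitz and circulant matrices agree off the boundary rows\<close>

lemma boundary_rows:
  obtains js where "length js \<le> 2 * d" "\<And>j. j \<in> set js \<longleftrightarrow> j < n \<and> \<not> (d \<le> j \<and> j + d < n)" "distinct js"
proof
  let ?js = "filter (\<lambda>j. \<not> (d \<le> j \<and> j + d < n)) [0..<n]"
  show "distinct ?js" by simp
  have "length ?js = card (set ?js)" by (simp add: distinct_card del: set_filter)
  also have "\<dots> \<le> card ({0..<d} \<union> {n - d..<n})" by (intro card_mono) auto
  also have "\<dots> \<le> 2 * d" using card_Un_le[of "{0..<d}" "{n - d..<n}"] by simp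
  finally show "length ?js \<le> 2 * d" .
qed auto

text \<open>A difference of matrices that is supported on the \<open>2 d\<close> boundary rows vanishes on the common
kernel of these rows. Low-rank perturbations enter the argument only in this form.\<close>

lemma equal_off_few_functionals:
  fixes A B :: "complex mat"
  assumes A: "A \<in> carrier_mat n n" and B: "B \<in> carrier_mat n n"
    and eq: "\<And>j k. d \<le> j \<Longrightarrow> j + d < n \<Longrightarrow> k < n \<Longrightarrow> A $$ (j, k) = B $$ (j, k)"
  obtains vs where "set vs \<subseteq> carrier_vec n" "length vs \<le> 2 * d"
    "\<And>x. x \<in> carrier_vec n \<Longrightarrow> (\<forall>v\<in>set vs. v \<bullet> x = 0) \<Longrightarrow> A *\<^sub>v x = B *\<^sub>v x"
proof -
  obtain js where js: "length js \<le> 2 * d" "\<And>j. j \<in> set js \<longleftrightarrow> j < n \<and> \<not> (d \<le> j \<and> j + d < n)"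
    using boundary_rows[of d n] by metis
  show thesis
  proof
    show "set (map (\<lambda>j. row A j - row B j) js) \<subseteq> carrier_vec n"
      using carrier_matD[OF B] by (auto intro!: carrier_vecI)
    show "length (map (\<lambda>j. row A j - row B j) js) \<le> 2 * d" using js by simp
    fix x assume x: "x \<in> carrier_vec n" and z: "\<forall>v\<in>set (map (\<lambda>j. row A j - row B j) js). v \<bullet> x = 0"
    show "A *\<^sub>v x = B *\<^sub>v x"
    proof (rule eq_vecI)
      fix j assume "j < dim_vec (B *\<^sub>v x)"
      then have j: "j < n" using B by simp
      show "(A *\<^sub>v x) $ j = (B *\<^sub>v x) $ j"
      proof (cases "j \<in> set js")
        case True
        then have "(row A j - row B j) \<bullet> x = 0" using z by auto
        then show ?thesis
          using minus_scalar_prod_distrib[of "row A j" n "row B j" x] A B x j by simp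
      next
        case False
        then have "row A j = row B j" using js(2)[of j] j A B by (intro eq_vecI) (auto intro!: eq)
        then show ?thesis using A B j by simp
      qed
    qed (use A B in auto)
  qed
qed

lemma toeplitz_product_rows:
  assumes q: "continuous_on {-pi..pi} q"
    and g: "g = (\<lambda>x. \<Sum>k = -int d..int d. a k * cis (of_int k * x))"
    and j: "d \<le> j" "j + d < n" and k: "k < n"
  shows "(toeplitz_fun n g * toeplitz_fun n q) $$ (j, k) = toeplitz_fun n (\<lambda>x. g x * q x) $$ (j, k)"
proof -
  have gc: "fourier_coeff g m = (if m \<in> {-int d..int d} then a m else 0)" for m
    unfolding g by (rule fourier_coeff_trig) simp
  have "(toeplitz_fun n g * toeplitz_fun n q) $$ (j, k)
      = (\<Sum>l = 0..<n. fourier_coeff g (int j - int l) * fourier_coeff q (int l - int k))"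
    using j k by (simp add: scalar_prod_def)
  also have "\<dots> = (\<Sum>l = 0..<n. (\<lambda>m. fourier_coeff g m * fourier_coeff q (int j - int k - m)) (int j - int l))"
    by simp
  also have "\<dots> = (\<Sum>m = -int d..int d. fourier_coeff g m * fourier_coeff q (int j - int k - m))"
    by (rule banded_row_sum) (use j in \<open>auto simp: gc\<close>)
  also have "\<dots> = (\<Sum>m = -int d..int d. a m * fourier_coeff q (int j - int k - m))"
    by (intro sum.cong) (auto simp: gc)
  also have "\<dots> = fourier_coeff (\<lambda>x. g x * q x) (int j - int k)"
    unfolding g using q by (intro fourier_coeff_trig_mult[symmetric]) auto
  finally show ?thesis using j k by simp
qed

text \<open>For a trigonometric polynomial of degree \<open>d\<close> the circulant differs from the Toeplitz matrix only
by the wrap-around of the band, which stays in the corners.\<close>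

lemma circulant_toeplitz_rows:
  assumes p: "p = (\<lambda>x. \<Sum>m = -int d..int d. a m * cis (of_int m * x))"
    and j: "d \<le> j" "j + d < n" and k: "k < n"
  shows "circulant_fun n p $$ (j, k) = toeplitz_fun n p $$ (j, k)"
proof -
  have n: "n > 0" and jn: "j < n" using j by auto
  have "p (2 * pi * real l / real n) * cis (2 * pi * real l * of_int (int k - int j) / real n)
      = (\<Sum>m = -int d..int d. a m * cis (2 * pi * real l * of_int (m + int k - int j) / real n))" for l
    unfolding p sum_distrib_right mult.assoc cis_mult
    using n by (intro sum.cong refl) (simp add: field_simps)
  then have "circulant_fun n p $$ (j, k) = (\<Sum>l = 0..<n. \<Sum>m = -int d..int d.
      a m * cis (2 * pi * real l * of_int (m + int k - int j) / real n)) / of_nat n"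
    using circulant_ev_index[OF jn k] by (simp add: circulant_fun_ev)
  also have "(\<Sum>l = 0..<n. \<Sum>m = -int d..int d. a m * cis (2 * pi * real l * of_int (m + int k - int j) / real n))
    = (\<Sum>m = -int d..int d. a m * (\<Sum>l = 0..<n. cis (2 * pi * real l * of_int (m + int k - int j) / real n)))"
    unfolding sum_distrib_left by (rule sum.swap)
  also have "\<dots> = (\<Sum>m = -int d..int d. if m = int j - int k then of_nat n * a (int j - int k) else 0)"
  proof (intro sum.cong refl)
    fix m assume m: "m \<in> {-int d..int d}"
    have "int n dvd m + int k - int j \<longleftrightarrow> m = int j - int k"
    proof
      assume dvd: "int n dvd m + int k - int j"
      have "\<bar>m + int k - int j\<bar> < int n" using m j k by auto
      then show "m = int j - int k" using dvd_imp_le_int[OF _ dvd] by (cases "m + int k - int j = 0") auto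
    qed simp
    then show "a m * (\<Sum>l = 0..<n. cis (2 * pi * real l * of_int (m + int k - int j) / real n))
      = (if m = int j - int k then of_nat n * a (int j - int k) else 0)"
      unfolding sum_cis_roots[OF n] by auto
  qed
  also have "\<dots> = of_nat n * (if int j - int k \<in> {-int d..int d} then a (int j - int k) else 0)"
    by (simp add: sum.delta)
  also have "(if int j - int k \<in> {-int d..int d} then a (int j - int k) else 0) = fourier_coeff p (int j - int k)"
    unfolding p by (rule fourier_coeff_trig[symmetric]) simp
  finally show ?thesis using n jn k by simp
qed

section \<open>Eigenvalues of the optimal circulant\<close>

text \<open>Written out in Fourier coefficients, \<open>optimal_ev n h l\<close> is the \<open>n\<close>-th Fejer mean of \<open>h\<close> at
\<open>2 \<pi> l / n\<close>. These values are bounded by the supremum of \<open>h\<close> and converge uniformly for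
trigonometric polynomials, so they converge uniformly for every continuous periodic function.\<close>

definition optimal_ev :: "nat \<Rightarrow> (real \<Rightarrow> complex) \<Rightarrow> nat \<Rightarrow> complex" where
  "optimal_ev n h l = (\<Sum>a = 0..<n. \<Sum>b = 0..<n.
    fourier_coeff h (int a - int b) * cis (2 * pi * real l * of_int (int a - int b) / real n)) / of_nat n"

lemma optimal_circulant_toeplitz_ev:
  "n > 0 \<Longrightarrow> optimal_circulant n (toeplitz_fun n h) = circulant_ev n (optimal_ev n h)"
  by (subst optimal_circulant_eigenvalues) (auto simp: optimal_ev_def[abs_def] intro!: arg_cong[of _ _ "circulant_ev n"])

lemma optimal_ev_bound:
  assumes h: "continuous_on {-pi..pi} h" and c: "\<And>x. x \<in> {-pi..pi} \<Longrightarrow> cmod (h x) \<le> c" and n: "n > 0"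
  shows "cmod (optimal_ev n h l) \<le> c"
proof -
  let ?a = "\<lambda>k::nat. cis (- (2 * pi * real l * real k / real n))"
  have e: "cis (2 * pi * real l * of_int (int j - int k) / real n) = ?a k * cnj (?a j)" for j k
    by (simp add: cis_cnj cis_mult algebra_simps diff_divide_distrib)
  have "optimal_ev n h l = (\<Sum>j = 0..<n. \<Sum>k = 0..<n. fourier_coeff h (int j - int k) * ?a k * cnj (?a j)) / of_nat n"
    unfolding optimal_ev_def e by (simp add: mult.assoc)
  then have "cmod (optimal_ev n h l) =
    cmod (\<Sum>j = 0..<n. \<Sum>k = 0..<n. fourier_coeff h (int j - int k) * ?a k * cnj (?a j)) / real n"
    by (simp add: norm_divide)
  also have "\<dots> \<le> (c / 2 * ((\<Sum>k = 0..<n. (cmod (?a k))\<^sup>2) + (\<Sum>j = 0..<n. (cmod (?a j))\<^sup>2))) / real n"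
    by (intro divide_right_mono toeplitz_form_bound h c) auto
  also have "\<dots> = c" using n by simp
  finally show ?thesis .
qed

text \<open>Each of the \<open>n\<close> inner sums over an interior row equals the value of \<open>p\<close> exactly; the at most
\<open>2 d\<close> remaining ones are off by a bounded amount, so their average contributes \<open>O(1 / n)\<close>.\<close>

lemma optimal_ev_trig:
  assumes p: "p = (\<lambda>x. \<Sum>m = -int d..int d. a m * cis (of_int m * x))" and n: "n > 0"
  shows "cmod (optimal_ev n p l - p (2 * pi * real l / real n))
    \<le> 4 * real d * (\<Sum>m = -int d..int d. cmod (a m)) / real n"
proof -
  define x where "x = 2 * pi * real l / real n"
  define C where "C = (\<Sum>m = -int d..int d. cmod (a m))"
  define F where "F m = fourier_coeff p m * cis (of_int m * x)" for m
  have pc: "fourier_coeff p m = (if m \<in> {-int d..int d} then a m else 0)" for m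
    unfolding p by (rule fourier_coeff_trig) simp
  have C0: "C \<ge> 0" by (simp add: C_def sum_nonneg)
  have px: "p x = (\<Sum>m = -int d..int d. F m)" unfolding p F_def
    by (intro sum.cong refl) (simp add: pc[unfolded p])
  obtain js where js: "length js \<le> 2 * d" "\<And>j. j \<in> set js \<longleftrightarrow> j < n \<and> \<not> (d \<le> j \<and> j + d < n)" "distinct js"
    using boundary_rows[of d n] by metis
  have row: "cmod ((\<Sum>b = 0..<n. F (int j - int b)) - p x) \<le> (if j \<in> set js then 2 * C else 0)" if j: "j < n" for j
  proof (cases "j \<in> set js")
    case False
    then have "(\<Sum>b = 0..<n. F (int j - int b)) = p x"
      unfolding px using js(2)[of j] j by (intro banded_row_sum) (auto simp: F_def pc)
    then show ?thesis using False by simp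
  next
    case True
    have Fn: "cmod (F m) = (if m \<in> {-int d..int d} then cmod (a m) else 0)" for m
      by (simp add: F_def pc norm_mult)
    have "cmod (p x) \<le> C"
      unfolding px C_def by (intro sum_norm_le) (simp add: Fn)
    moreover have "cmod (\<Sum>b = 0..<n. F (int j - int b)) \<le> C"
    proof -
      have "cmod (\<Sum>b = 0..<n. F (int j - int b)) \<le> (\<Sum>b = 0..<n. cmod (F (int j - int b)))"
        by (rule norm_sum)
      also have "\<dots> = (\<Sum>m\<in>(\<lambda>b. int j - int b) ` {0..<n}. cmod (F m))"
        by (subst sum.reindex) (auto simp: inj_on_def)
      also have "\<dots> \<le> (\<Sum>m\<in>(\<lambda>b. int j - int b) ` {0..<n} \<union> {-int d..int d}. cmod (F m))"
        by (intro sum_mono2) auto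
      also have "\<dots> = (\<Sum>m\<in>{-int d..int d}. cmod (F m))"
        by (rule sum.mono_neutral_right) (auto simp: Fn)
      also have "\<dots> = C" unfolding C_def by (intro sum.cong) (auto simp: Fn)
      finally show ?thesis .
    qed
    ultimately show ?thesis
      using True norm_triangle_ineq4[of "\<Sum>b = 0..<n. F (int j - int b)" "p x"] by simp
  qed
  have "optimal_ev n p l = (\<Sum>j = 0..<n. \<Sum>b = 0..<n. F (int j - int b)) / of_nat n"
    unfolding optimal_ev_def F_def x_def by (simp add: mult_ac)
  then have "optimal_ev n p l - p x = (\<Sum>j = 0..<n. (\<Sum>b = 0..<n. F (int j - int b)) - p x) / of_nat n"
    using n by (simp add: sum_subtractf diff_divide_distrib)
  then have "cmod (optimal_ev n p l - p x) = cmod (\<Sum>j = 0..<n. (\<Sum>b = 0..<n. F (int j - int b)) - p x) / real n"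
    by (simp add: norm_divide)
  also have "\<dots> \<le> (\<Sum>j = 0..<n. if j \<in> set js then 2 * C else 0) / real n"
    by (intro divide_right_mono sum_norm_le row) auto
  also have "(\<Sum>j = 0..<n. if j \<in> set js then 2 * C else 0) = (\<Sum>j\<in>set js. 2 * C)"
    by (rule sum.mono_neutral_cong_right) (auto simp: js(2))
  also have "\<dots> \<le> 4 * real d * C"
    using js C0 mult_right_mono[of "real (length js)" "2 * real d" "2 * C"] by (simp add: distinct_card)
  finally show ?thesis unfolding C_def x_def by (simp add: divide_right_mono)
qed

section \<open>Inverses and the quotient symbol\<close>

lemma inv_mat:
  assumes A: "A \<in> carrier_mat n n" and inv: "invertible_mat A"
  shows "inv_mat A \<in> carrier_mat n n" "A * inv_mat A = 1\<^sub>m n" "inv_mat A * A = 1\<^sub>m n"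
proof -
  obtain B where B: "A * B = 1\<^sub>m n" "B * A = 1\<^sub>m (dim_row B)"
    using inv A by (auto simp: invertible_mat_def inverts_mat_def)
  have "dim_col B = n" using arg_cong[OF B(1), of dim_col] by simp
  moreover have "dim_row B = n" using arg_cong[OF B(2), of dim_col] A by simp
  ultimately have "A \<in> Units (ring_mat TYPE(complex) n ())"
    using A B by (auto simp: Units_def ring_mat_def intro!: bexI[of _ B])
  then obtain C where "mat_inverse A = Some C"
    using mat_inverse(1)[OF A, of "()"] by (cases "mat_inverse A") auto
  then show "inv_mat A \<in> carrier_mat n n" "A * inv_mat A = 1\<^sub>m n" "inv_mat A * A = 1\<^sub>m n"
    using mat_inverse(2)[OF A] by (auto simp: inv_mat_def)
qed

lemma invertible_circulant_ev:
  assumes c: "c > 0" "\<And>i. i < n \<Longrightarrow> cmod (ev i) \<ge> c"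
  shows "invertible_mat (circulant_ev n ev)"
proof -
  have "det (circulant_ev n ev) \<noteq> 0"
  proof
    assume "det (circulant_ev n ev) = 0"
    then obtain v where v: "v \<in> carrier_vec n" "v \<noteq> 0\<^sub>v n" "circulant_ev n ev *\<^sub>v v = 0\<^sub>v n"
      using det_0_iff_vec_prod_zero_field[OF circulant_ev_carrier] by metis
    have "c * vnorm v \<le> 0" using circulant_ev_norm_lower[of v n c ev, OF v(1) c] v(3) by simp
    moreover have "c * vnorm v > 0" using c vnorm_pos[OF v(1,2)] by simp
    ultimately show False by simp
  qed
  from det_non_zero_imp_unit[OF circulant_ev_carrier this, of "()"] show ?thesis
    by (auto simp: Units_def ring_mat_def invertible_mat_def inverts_mat_def square_mat.simps)
qed

lemma Lim_shift:
  assumes "\<And>x. F (x + a) = (F x :: complex)"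
  shows "Lim (at (x + a)) F = Lim (at (x :: real)) F"
proof -
  have "(F \<longlongrightarrow> l) (at (x + a)) \<longleftrightarrow> (F \<longlongrightarrow> l) (at x)" for l
  proof -
    have "at (x + a) = filtermap (\<lambda>y. y + a) (at x)"
      using filtermap_at_shift[of "-a" x] by simp
    then have "(F \<longlongrightarrow> l) (at (x + a)) \<longleftrightarrow> ((\<lambda>y. F (y + a)) \<longlongrightarrow> l) (at x)"
      by (simp add: filterlim_filtermap)
    then show ?thesis by (simp add: assms)
  qed
  then show ?thesis unfolding Topological_Spaces.Lim_def by simp
qed

lemma ext_quotient_periodic:
  assumes "\<And>x. f (x + a) = f x" "\<And>x. g (x + a) = g x"
  shows "ext_quotient f g (x + a) = ext_quotient f g x"
  using Lim_shift[of "\<lambda>y. f y / g y" a x] by (simp add: ext_quotient_def assms)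

text \<open>At a zero of \<open>g\<close> the identity is a consequence of continuity unless \<open>g\<close> vanishes in a whole
neighbourhood. There \<open>f / g\<close> would be the constant \<open>0\<close> (division by zero), hence so would be its
limit, which is excluded because the quotient has no zero.\<close>

lemma ext_quotient_mult:
  assumes f: "isCont f x" and g: "isCont g x" and q: "isCont (ext_quotient f g) x"
    and nz: "ext_quotient f g x \<noteq> 0"
  shows "f x = g x * ext_quotient f g x"
proof (rule ccontr)
  assume ne: "f x \<noteq> g x * ext_quotient f g x"
  then have gx: "g x = 0" by (cases "g x = 0") (simp_all add: ext_quotient_def)
  have "isCont (\<lambda>y. f y - g y * ext_quotient f g y) x" by (intro continuous_intros f g q)
  then have "\<forall>\<^sub>F y in at x. f y - g y * ext_quotient f g y \<noteq> 0"
    using ne unfolding isCont_def by (intro tendsto_imp_eventually_ne[of _ "f x - g x * ext_quotient f g x"]) auto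
  then have "\<forall>\<^sub>F y in at x. f y / g y = 0"
    by eventually_elim (auto simp: ext_quotient_def split: if_splits)
  then have "((\<lambda>y. f y / g y) \<longlongrightarrow> 0) (at x)" by (rule tendsto_eventually)
  then have "ext_quotient f g x = 0"
    using gx by (simp add: ext_quotient_def tendsto_Lim)
  with nz show False by simp
qed

section \<open>Singular values of the preconditioned matrix\<close>

text \<open>The polynomial \<open>p\<close> is the intermediary: replacing \<open>q\<close> by \<open>p\<close> changes both matrices by little
in norm, and the vectors \<open>x\<close> considered do not see the difference between the Toeplitz and the
circulant matrix of \<open>p\<close>.\<close>

lemma toeplitz_circulant_close:
  assumes p: "p = (\<lambda>x. \<Sum>m = -int d..int d. b m * cis (of_int m * x))"
    and q: "continuous_on {-pi..pi} q"
    and near: "\<And>y. y \<in> {-pi..pi} \<Longrightarrow> cmod (q y - p y) \<le> \<delta>"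
    and ev: "\<And>l. l < n \<Longrightarrow> cmod (p (2 * pi * real l / real n) - ev l) \<le> \<eta>" and n: "n > 0"
    and x: "x \<in> carrier_vec n"
    and eq: "toeplitz_fun n p *\<^sub>v x = circulant_fun n p *\<^sub>v x"
  shows "vnorm (toeplitz_fun n q *\<^sub>v x - circulant_ev n ev *\<^sub>v x) \<le> (\<delta> + \<eta>) * vnorm x"
proof -
  have pc: "continuous_on {-pi..pi} p"
    unfolding p by (intro continuous_intros)
  have T: "toeplitz_fun n q = toeplitz_fun n p + toeplitz_fun n (\<lambda>y. q y - p y)"
    by (intro eq_matI) (auto simp: fourier_coeff_diff[OF q pc])
  have C: "circulant_ev n ev = circulant_fun n p - circulant_ev n (\<lambda>l. p (2 * pi * real l / real n) - ev l)"
    unfolding circulant_fun_ev circulant_ev_diff by simp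
  have "toeplitz_fun n q *\<^sub>v x = toeplitz_fun n p *\<^sub>v x + toeplitz_fun n (\<lambda>y. q y - p y) *\<^sub>v x"
    unfolding T by (rule add_mult_distrib_mat_vec[OF _ _ x]) auto
  moreover have "circulant_ev n ev *\<^sub>v x = circulant_fun n p *\<^sub>v x - circulant_ev n (\<lambda>l. p (2 * pi * real l / real n) - ev l) *\<^sub>v x"
    unfolding C by (rule minus_mult_distrib_mat_vec[OF _ _ x]) (auto simp: circulant_fun_ev)
  ultimately have "toeplitz_fun n q *\<^sub>v x - circulant_ev n ev *\<^sub>v x
    = toeplitz_fun n (\<lambda>y. q y - p y) *\<^sub>v x + circulant_ev n (\<lambda>l. p (2 * pi * real l / real n) - ev l) *\<^sub>v x"
    unfolding eq by (intro eq_vecI) (auto simp: circulant_fun_ev)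
  moreover have "vnorm (toeplitz_fun n (\<lambda>y. q y - p y) *\<^sub>v x) \<le> \<delta> * vnorm x"
    by (rule toeplitz_norm_bound[OF _ near x]) (auto intro!: continuous_intros q pc)
  moreover have "vnorm (circulant_ev n (\<lambda>l. p (2 * pi * real l / real n) - ev l) *\<^sub>v x) \<le> \<eta> * vnorm x"
    using order_trans[OF norm_ge_zero ev[OF n]] ev by (intro circulant_ev_norm_upper[OF x]) auto
  ultimately show ?thesis
    using vnorm_triangle[of "toeplitz_fun n (\<lambda>y. q y - p y) *\<^sub>v x" n "circulant_ev n (\<lambda>l. p (2 * pi * real l / real n) - ev l) *\<^sub>v x"]
      mult_mat_vec_carrier[OF toeplitz_carrier(2) x] mult_mat_vec_carrier[OF circulant_ev_carrier x]
    by (simp add: distrib_right)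
qed

text \<open>On vectors that are annihilated by the boundary rows of \<open>T(f) - T(g) T(q)\<close> and of
\<open>T(p) - C(p)\<close>, the product \<open>T(g)\<^sup>-\<^sup>1 T(f)\<close> acts as \<open>T(q)\<close>, and \<open>T(q) x\<close> is close
to \<open>P x\<close>. The lower bound for \<open>P\<close> carries the estimate over to \<open>P\<^sup>-\<^sup>1 T(q) x\<close>
and \<open>x\<close>, whereas \<open>T(g)\<^sup>-\<^sup>1\<close> cancels exactly; this matters because \<open>g\<close> may have zeros, and
then these inverses need not be uniformly bounded.\<close>

lemma preconditioned_singular_values:
  assumes g: "g = (\<lambda>x. \<Sum>m = -int d..int d. a m * cis (of_int m * x))"
    and p: "p = (\<lambda>x. \<Sum>m = -int e..int e. b m * cis (of_int m * x))"
    and q: "continuous_on {-pi..pi} q" and f: "\<And>y. y \<in> {-pi..pi} \<Longrightarrow> f y = g y * q y"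
    and near: "\<And>y. y \<in> {-pi..pi} \<Longrightarrow> cmod (q y - p y) \<le> \<delta>"
    and ev: "\<And>l. l < n \<Longrightarrow> cmod (p (2 * pi * real l / real n) - ev l) \<le> \<eta>"
    and c: "c > 0" "\<And>l. l < n \<Longrightarrow> cmod (ev l) \<ge> c"
    and small: "\<delta> + \<eta> \<le> \<epsilon> * c" and \<epsilon>: "\<epsilon> > 0" and n: "n > 0"
    and inv: "invertible_mat (toeplitz_fun n g)"
  shows "size (filter_mset (\<lambda>s. s \<notin> {1 - \<epsilon>..1 + \<epsilon>})
      (singular_values (inv_mat (circulant_ev n ev) * inv_mat (toeplitz_fun n g) * toeplitz_fun n f))) \<le> 4 * (d + e)"
proof -
  define P where "P = circulant_ev n ev"
  define G where "G = toeplitz_fun n g"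
  define Q where "Q = toeplitz_fun n q"
  define T where "T = toeplitz_fun n f"
  have carr: "P \<in> carrier_mat n n" "G \<in> carrier_mat n n" "Q \<in> carrier_mat n n" "T \<in> carrier_mat n n"
    by (simp_all add: P_def G_def Q_def T_def)
  note P = inv_mat[OF carr(1) invertible_circulant_ev[of c n ev, OF c, folded P_def]]
  note G = inv_mat[OF carr(2) inv[folded G_def]]
  have Tf: "T = toeplitz_fun n (\<lambda>x. g x * q x)"
  proof -
    have "fourier_coeff f m = fourier_coeff (\<lambda>x. g x * q x) m" for m
      unfolding fourier_coeff_def using f by (intro arg_cong2[of _ _ _ _ "(*)"] refl integral_cong) simp
    then have "fourier_coeff f = fourier_coeff (\<lambda>x. g x * q x)" by blast
    then show ?thesis by (simp add: T_def toeplitz_fun_def)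
  qed
  have rows1: "T $$ (j, k) = (G * Q) $$ (j, k)" if "d \<le> j" "j + d < n" "k < n" for j k
    unfolding Tf G_def Q_def by (rule toeplitz_product_rows[OF q g that, symmetric])
  obtain us where us: "set us \<subseteq> carrier_vec n" "length us \<le> 2 * d"
    "\<And>x. x \<in> carrier_vec n \<Longrightarrow> (\<forall>v\<in>set us. v \<bullet> x = 0) \<Longrightarrow> T *\<^sub>v x = (G * Q) *\<^sub>v x"
    by (rule equal_off_few_functionals[OF carr(4) mult_carrier_mat[OF carr(2,3)] rows1]) blast+
  have rows2: "toeplitz_fun n p $$ (j, k) = circulant_fun n p $$ (j, k)" if "e \<le> j" "j + e < n" "k < n" for j k
    by (rule circulant_toeplitz_rows[OF p that, symmetric])
  have Cp: "circulant_fun n p \<in> carrier_mat n n" by (simp add: circulant_fun_ev)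
  obtain ws where ws: "set ws \<subseteq> carrier_vec n" "length ws \<le> 2 * e"
    "\<And>x. x \<in> carrier_vec n \<Longrightarrow> (\<forall>v\<in>set ws. v \<bullet> x = 0) \<Longrightarrow> toeplitz_fun n p *\<^sub>v x = circulant_fun n p *\<^sub>v x"
    by (rule equal_off_few_functionals[OF toeplitz_carrier(2) Cp rows2]) blast+
  define A where "A = inv_mat P * inv_mat G * T"
  have A: "A \<in> carrier_mat n n" using P G carr by (auto simp: A_def)
  have "size (filter_mset (\<lambda>s. s \<notin> {1 - \<epsilon>..1 + \<epsilon>}) (singular_values A)) \<le> 2 * length (us @ ws)"
  proof (rule singular_values_count[OF A _ \<epsilon>])
    show "set (us @ ws) \<subseteq> carrier_vec n" using us ws by auto
    fix x assume x: "x \<in> carrier_vec n" and z: "\<forall>v\<in>set (us @ ws). v \<bullet> x = 0"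
    have Qx: "Q *\<^sub>v x \<in> carrier_vec n" by (rule mult_mat_vec_carrier[OF carr(3) x])
    have y: "A *\<^sub>v x \<in> carrier_vec n" by (rule mult_mat_vec_carrier[OF A x])
    have "A *\<^sub>v x = inv_mat P *\<^sub>v (inv_mat G *\<^sub>v (T *\<^sub>v x))"
      unfolding A_def
      by (simp only: assoc_mult_mat_vec[OF mult_carrier_mat[OF P(1) G(1)] carr(4) x]
          assoc_mult_mat_vec[OF P(1) G(1) mult_mat_vec_carrier[OF carr(4) x]])
    also have "T *\<^sub>v x = G *\<^sub>v (Q *\<^sub>v x)"
      using us(3)[OF x] z assoc_mult_mat_vec[OF carr(2,3) x] by simp
    also have "inv_mat G *\<^sub>v (G *\<^sub>v (Q *\<^sub>v x)) = Q *\<^sub>v x"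
      using assoc_mult_mat_vec[OF G(1) carr(2) Qx] Qx by (simp add: G(3))
    finally have "P *\<^sub>v (A *\<^sub>v x) = Q *\<^sub>v x"
      using assoc_mult_mat_vec[OF carr(1) P(1) Qx] Qx by (simp add: P(2))
    then have PA: "P *\<^sub>v (A *\<^sub>v x - x) = Q *\<^sub>v x - P *\<^sub>v x"
      using mult_minus_distrib_mat_vec[OF carr(1) y x] by simp
    have "c * vnorm (A *\<^sub>v x - x) \<le> vnorm (P *\<^sub>v (A *\<^sub>v x - x))"
      unfolding P_def using y x by (intro circulant_ev_norm_lower c) auto
    also have "\<dots> \<le> (\<delta> + \<eta>) * vnorm x"
      unfolding PA unfolding P_def Q_def
      by (rule toeplitz_circulant_close[OF p q near ev n x]) (use ws(3)[OF x] z in auto)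
    also have "\<dots> \<le> c * (\<epsilon> * vnorm x)"
      using mult_right_mono[OF small vnorm_nonneg[of x]] by (simp add: mult_ac)
    finally show "vnorm (A *\<^sub>v x - x) \<le> \<epsilon> * vnorm x" using c(1) by simp
  qed
  also have "\<dots> \<le> 4 * (d + e)" using us(2) ws(2) by simp
  finally show ?thesis by (simp add: A_def P_def G_def T_def)
qed

lemma size_singular_values:
  "A \<in> carrier_mat n n \<Longrightarrow> size (singular_values A) = n"
  using degree_monic_char_poly[of "mat_adjoint A * A" n] mult_carrier_mat[OF mat_adjoint_carrier, of A n n A n]
  by (simp add: singular_values_def size_proots_complex)

text \<open>Both preconditioners are circulants whose eigenvalues approximate \<open>p\<close> at the grid points; this
is all that the sequel uses of them.\<close>

lemma preconditioner_is_circulant: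
  assumes p: "p = (\<lambda>x. \<Sum>m = -int e..int e. b m * cis (of_int m * x))"
    and q: "continuous_on {-pi..pi} q" and near: "\<And>y. cmod (q y - p y) \<le> \<delta>" and \<delta>: "\<delta> > 0"
    and P: "P = (\<lambda>n. circulant_fun n q) \<or> P = (\<lambda>n. optimal_circulant n (toeplitz_fun n q))"
  shows "\<forall>\<^sub>F n in sequentially. \<exists>ev. P n = circulant_ev n ev \<and> (\<forall>l<n. cmod (p (2 * pi * real l / real n) - ev l) \<le> 2 * \<delta>)"
  using P
proof
  assume P: "P = (\<lambda>n. circulant_fun n q)"
  have "cmod (p y - q y) \<le> 2 * \<delta>" for y
    using near[of y] \<delta> by (simp add: norm_minus_commute)
  then show ?thesis unfolding P circulant_fun_ev by (intro always_eventually) auto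
next
  assume P: "P = (\<lambda>n. optimal_circulant n (toeplitz_fun n q))"
  define C where "C = 4 * real e * (\<Sum>m = -int e..int e. cmod (b m))"
  have "((\<lambda>n. C / real n) \<longlongrightarrow> 0) sequentially" by (rule lim_const_over_n)
  then have "\<forall>\<^sub>F n in sequentially. C / real n < \<delta>" using \<delta> by (rule order_tendstoD)
  then show ?thesis using eventually_gt_at_top[of 0]
  proof eventually_elim
    case (elim n)
    have pc: "continuous_on {-pi..pi} p" unfolding p by (intro continuous_intros)
    have "cmod (p (2 * pi * real l / real n) - optimal_ev n q l) \<le> 2 * \<delta>" for l
    proof -
      have "optimal_ev n q l = optimal_ev n p l + optimal_ev n (\<lambda>y. q y - p y) l"
        unfolding optimal_ev_def fourier_coeff_diff[OF q pc]
        by (simp add: left_diff_distrib sum_subtractf diff_divide_distrib)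
      moreover have "cmod (optimal_ev n (\<lambda>y. q y - p y) l) \<le> \<delta>"
        by (rule optimal_ev_bound[OF _ near elim(2)]) (intro continuous_intros q pc)
      moreover have "cmod (optimal_ev n p l - p (2 * pi * real l / real n)) \<le> \<delta>"
        using optimal_ev_trig[OF p elim(2), of l] elim(1) unfolding C_def by linarith
      ultimately show ?thesis
        using norm_triangle_ineq[of "optimal_ev n p l - p (2 * pi * real l / real n)" "optimal_ev n (\<lambda>y. q y - p y) l"]
        by (simp add: norm_minus_commute algebra_simps)
    qed
    then show ?case unfolding P using optimal_circulant_toeplitz_ev[OF elim(2)] by blast
  qed
qed

theorem mainTheorem7:
  fixes f g :: "real \<Rightarrow> complex" and P :: "nat \<Rightarrow> complex mat" and \<epsilon> :: real
  assumes f_periodic: "\<forall>x. f (x + 2 * pi) = f x"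
    and f_continuous: "continuous_on UNIV f"
    and f_zeros: "\<exists>x\<in>{-pi<..pi}. f x = 0"
    and g_trig: "trig_polynomial g"
    and quotient_continuous: "continuous_on UNIV (ext_quotient f g)"
    and quotient_no_zeros: "\<forall>x\<in>{-pi<..pi}. ext_quotient f g x \<noteq> 0"
    and P: "P = (\<lambda>n. circulant_fun n (ext_quotient f g)) \<or>
            P = (\<lambda>n. optimal_circulant n (toeplitz_fun n (ext_quotient f g)))"
    and \<epsilon>: "\<epsilon> > 0"
  shows "(\<forall>\<^sub>F n in sequentially. invertible_mat (P n)) \<and>
    proper_cluster {n. n > 0 \<and> invertible_mat (P n) \<and> invertible_mat (toeplitz_fun n g)}
      {1 - \<epsilon>..1 + \<epsilon>}
      (\<lambda>n. inv_mat (P n) * inv_mat (toeplitz_fun n g) * toeplitz_fun n f)"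
proof -
  define q where "q = ext_quotient f g"
  have q_cont: "continuous_on S q" for S
    using quotient_continuous continuous_on_subset unfolding q_def by blast
  have q_per: "q (x + 2 * pi) = q x" for x
    unfolding q_def using f_periodic trig_polynomial_periodic[OF g_trig] by (intro ext_quotient_periodic) auto
  have q_nz: "q x \<noteq> 0" for x
  proof -
    have "Arg (cis x) \<in> {-pi<..pi}" using Arg_bounded[of "cis x"] by auto
    then show ?thesis using quotient_no_zeros periodic_Arg[of q, OF q_per] unfolding q_def by metis
  qed
  have fgq: "f x = g x * q x" for x
    unfolding q_def
    using f_continuous trig_polynomial_continuous[OF g_trig, of UNIV] quotient_continuous q_nz[of x, unfolded q_def]
    by (intro ext_quotient_mult) (auto simp: continuous_on_eq_continuous_at)
  obtain c where c: "c > 0" "\<And>x. c \<le> cmod (q x)"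
  proof -
    obtain x0 where "x0 \<in> {-pi..pi}" "\<And>x. x \<in> {-pi..pi} \<Longrightarrow> cmod (q x0) \<le> cmod (q x)"
      using continuous_attains_inf[of "{-pi..pi}" "\<lambda>x. cmod (q x)"] continuous_on_norm[OF q_cont] by auto
    moreover have "Arg (cis x) \<in> {-pi..pi}" for x using Arg_bounded[of "cis x"] by auto
    ultimately have "cmod (q x0) \<le> cmod (q x)" for x
      using periodic_Arg[of q, OF q_per] by metis
    then show thesis using that[of "cmod (q x0)"] q_nz[of x0] by simp
  qed
  \<comment> \<open>The eigenvalues of \<open>P n\<close> will be within \<open>3 \<delta>\<close> of \<open>q\<close>, so \<open>3 \<delta> \<le> c / 2\<close> keeps them at
    distance \<open>c / 2\<close> from zero; the factor \<open>\<epsilon>\<close> makes the error small relative to this bound.\<close>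
  define \<delta> where "\<delta> = min \<epsilon> 1 * c / 6"
  have \<delta>: "\<delta> > 0" "3 * \<delta> \<le> c / 2" "\<delta> + 2 * \<delta> \<le> \<epsilon> * (c / 2)"
    using \<epsilon> c(1) by (auto simp: \<delta>_def min_def field_simps)
  obtain p where p: "trig_polynomial p" "\<And>x. cmod (q x - p x) < \<delta>"
    using trigonometric_Weierstrass[OF q_cont q_per \<delta>(1)] by blast
  obtain e b where pe: "p = (\<lambda>x. \<Sum>m = -int e..int e. b m * cis (of_int m * x))"
    using p(1) by (rule trig_polynomialE)
  obtain d a where gd: "g = (\<lambda>x. \<Sum>m = -int d..int d. a m * cis (of_int m * x))"
    using g_trig by (rule trig_polynomialE)
  have near: "cmod (q x - p x) \<le> \<delta>" for x using p(2)[of x] by simp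
  obtain n0 where n0: "\<And>n. n \<ge> n0 \<Longrightarrow>
      \<exists>ev. P n = circulant_ev n ev \<and> (\<forall>l<n. cmod (p (2 * pi * real l / real n) - ev l) \<le> 2 * \<delta>)"
    using preconditioner_is_circulant[OF pe q_cont near \<delta>(1) P[folded q_def]]
    unfolding eventually_sequentially by auto
  have ev_lower: "c / 2 \<le> cmod w" if "cmod (p y - w) \<le> 2 * \<delta>" for w y
    using that near[of y] c(2)[of y] \<delta>(2)
      norm_triangle_ineq[of "q y - p y" "p y - w"] norm_triangle_ineq[of "q y - w" w] by simp
  have "\<forall>\<^sub>F n in sequentially. invertible_mat (P n)"
    unfolding eventually_sequentially
  proof (intro exI allI impI)
    fix n assume "n \<ge> n0"
    then obtain ev where "P n = circulant_ev n ev" "\<forall>l<n. cmod (p (2 * pi * real l / real n) - ev l) \<le> 2 * \<delta>"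
      using n0 by blast
    then show "invertible_mat (P n)"
      using invertible_circulant_ev[of "c / 2" n ev] c(1) ev_lower by auto
  qed
  moreover have "proper_cluster {n. n > 0 \<and> invertible_mat (P n) \<and> invertible_mat (toeplitz_fun n g)}
      {1 - \<epsilon>..1 + \<epsilon>} (\<lambda>n. inv_mat (P n) * inv_mat (toeplitz_fun n g) * toeplitz_fun n f)"
    unfolding proper_cluster_def
  proof (intro allI impI exI ballI)
    fix \<rho> :: real and n
    assume n: "n \<in> {n. n > 0 \<and> invertible_mat (P n) \<and> invertible_mat (toeplitz_fun n g)}"
    let ?A = "inv_mat (P n) * inv_mat (toeplitz_fun n g) * toeplitz_fun n f"
    have "size (filter_mset (\<lambda>s. s \<notin> extension \<rho> {1 - \<epsilon>..1 + \<epsilon>}) (singular_values ?A))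
        \<le> size (filter_mset (\<lambda>s. s \<notin> {1 - \<epsilon>..1 + \<epsilon>}) (singular_values ?A))"
      by (intro size_mset_mono filter_mset_mono_strong) (auto simp: extension_def)
    also have "\<dots> \<le> max n0 (4 * (d + e))"
    \<comment> \<open>For the finitely many small \<open>n\<close> the trivial bound by the size of the matrix is enough.\<close>
    proof (cases "n \<ge> n0")
      case True
      then obtain ev where ev: "P n = circulant_ev n ev" "\<forall>l<n. cmod (p (2 * pi * real l / real n) - ev l) \<le> 2 * \<delta>"
        using n0 by blast
      have "size (filter_mset (\<lambda>s. s \<notin> {1 - \<epsilon>..1 + \<epsilon>}) (singular_values ?A)) \<le> 4 * (d + e)"
        unfolding ev(1)
        by (rule preconditioned_singular_values[OF gd pe q_cont fgq near, where \<eta> = "2 * \<delta>" and c = "c / 2"])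
          (use n ev(2) c(1) ev_lower \<delta>(3) \<epsilon> in auto)
      then show ?thesis by simp
    next
      case False
      have "?A \<in> carrier_mat n n"
      proof -
        have "P n \<in> carrier_mat n n"
          using P n by (auto simp: circulant_fun_ev optimal_circulant_toeplitz_ev)
        then show ?thesis using n inv_mat(1)[of "P n" n] inv_mat(1)[of "toeplitz_fun n g" n] by auto
      qed
      then have "size (filter_mset (\<lambda>s. s \<notin> {1 - \<epsilon>..1 + \<epsilon>}) (singular_values ?A)) \<le> n"
        using size_filter_mset_lesseq size_singular_values by metis
      then show ?thesis using False by simp
    qed
    finally show "size (filter_mset (\<lambda>s. s \<notin> extension \<rho> {1 - \<epsilon>..1 + \<epsilon>}) (singular_values ?A))
      \<le> max n0 (4 * (d + e))" .
  qed
  ultimately show ?thesis by blast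
qed

end
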